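(* Let $Q$ be any fixed unbounded regular path query on alphabet $\Sigma$. There is a polynomial-time reduction from ST-CON to the probabilistic query evaluation problem $\mathrm{PQE}_Q$ for $Q$. Formally, given an unlabelled graph $(H,\pi)$ with probabilistic edges and given vertices $s$ and $t$ of $H$, we can build in polynomial time a labelled graph $(H',\pi')$ with probabilistic edges on signature $\Sigma$ and vertices $s'$ and $t'$ of $H'$ such that the answer to ST-CON on $(H,\pi)$ (with $s$ and $t$) is the same as the answer to $\mathrm{PQE}_Q$ on $(H',\pi')$.
   Context: A graph over a finite non-empty set of labels $\Sigma$ is $(V,E,\lambda)$ with $V$ finite non-empty, $E\subseteq V^2$ (directed edges), $\lambda:E\to\Sigma$; it is unlabelled if there is a single label. A probabilistic graph $(H,\pi)$ has (rational) edge probabilities $\pi:E\to[0,1]$; a subgraph $H'$ (same vertices, edge subset $E'$, restricted labelling) has probability $\prod_{e\in E'}\pi(e)\prod_{e\in E\setminus E'}(1-\pi(e))$. ST-CON: given an unlabelled probabilistic graph $(H,\pi)$ and vertices $s,t$, compute the total probability of the subgraphs of $H$ containing a directed path from $s$ to $t$. Regular path queries: for a regular language $L\subseteq\Sigma^*$, the query $\mathsf{RPQ}(L)$ is satisfied by a graph $H$ over $\Sigma$ iff there is a word $a_1\cdots a_n\in L$ and a (not necessarily simple) directed walk in $H$ whose successive edges are labelled $a_1,\ldots,a_n$. For $Q=\mathsf{RPQ}(L)$, $\mathrm{PQE}_Q$ is the problem: given a probabilistic graph $(H,\pi)$ over $\Sigma$, compute the total probability of the subgraphs of $H$ satisfying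 $Q$. A word $u$ is an infix of $v$ if $v=sut$ for some $s,t\in\Sigma^*$, and a strict infix if moreover $u\neq v$. The infix-free sublanguage $\mathsf{IF}(L)$ of $L$ is the set of words of $L$ having no strict infix in $L$ (it is regular and defines the same query as $L$). $\mathsf{RPQ}(L)$ is bounded if $\mathsf{IF}(L)$ is finite, and unbounded otherwise. *)

theory Defs
  imports Complex_Main "HOL-Library.Sublist" "HOL-Computational_Algebra.Polynomial"
begin

section \<open>Graphs and probabilistic graphs\<close>

text \<open>
  The label alphabet is a type of class \<open>finite\<close>; an unlabelled graph has labels in \<open>unit\<close>.
  The functions \<open>lab\<close> and \<open>\<pi>\<close> are total in HOL, but their values matter only on the edges.
\<close>

record ('v, 'a) lgraph =
  verts :: "'v set"
  edges :: "('v \<times> 'v) set"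
  lab :: "'v \<times> 'v \<Rightarrow> 'a"

definition wf_graph :: "('v, 'a) lgraph \<Rightarrow> bool" where
  "wf_graph H \<longleftrightarrow> finite (verts H) \<and> verts H \<noteq> {} \<and> edges H \<subseteq> verts H \<times> verts H"

definition prob_graph :: "('v, 'a) lgraph \<Rightarrow> ('v \<times> 'v \<Rightarrow> rat) \<Rightarrow> bool" where
  "prob_graph H \<pi> \<longleftrightarrow> wf_graph H \<and> (\<forall>e\<in>edges H. 0 \<le> \<pi> e \<and> \<pi> e \<le> 1)"

definition subgraph_prob ::
  "('v, 'a) lgraph \<Rightarrow> ('v \<times> 'v \<Rightarrow> rat) \<Rightarrow> ('v \<times> 'v) set \<Rightarrow> rat" where
  "subgraph_prob H \<pi> E' = (\<Prod>e\<in>E'. \<pi> e) * (\<Prod>e\<in>edges H - E'. 1 - \<pi> e)"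

definition total_prob ::
  "(('v, 'a) lgraph \<Rightarrow> bool) \<Rightarrow> ('v, 'a) lgraph \<Rightarrow> ('v \<times> 'v \<Rightarrow> rat) \<Rightarrow> rat" where
  "total_prob Q H \<pi> =
     (\<Sum>E' \<in> {E'. E' \<subseteq> edges H \<and> Q (H\<lparr>edges := E'\<rparr>)}. subgraph_prob H \<pi> E')"


section \<open>ST-CON\<close>

text \<open>If \<open>s = t\<close>, the one-vertex path counts.\<close>

definition has_dipath :: "'v \<Rightarrow> 'v \<Rightarrow> ('v, 'a) lgraph \<Rightarrow> bool" where
  "has_dipath s t H \<longleftrightarrow>
     (\<exists>p. p \<noteq> [] \<and> distinct p \<and> set p \<subseteq> verts H \<and> hd p = s \<and> last p = t \<and>
          (\<forall>i. Suc i < length p \<longrightarrow> (p ! i, p ! Suc i) \<in> edges H))"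

definition stcon :: "('v, unit) lgraph \<Rightarrow> ('v \<times> 'v \<Rightarrow> rat) \<Rightarrow> 'v \<Rightarrow> 'v \<Rightarrow> rat" where
  "stcon H \<pi> s t = total_prob (has_dipath s t) H \<pi>"


section \<open>Regular path queries\<close>

text \<open>Recognizability by a complete deterministic finite automaton.\<close>

definition regular_language :: "'a list set \<Rightarrow> bool" where
  "regular_language L \<longleftrightarrow>
     (\<exists>(S :: nat set) q0 F (\<delta> :: nat \<Rightarrow> 'a \<Rightarrow> nat).
        finite S \<and> q0 \<in> S \<and> F \<subseteq> S \<and> (\<forall>q\<in>S. \<forall>a. \<delta> q a \<in> S) \<and>
        L = {w. foldl \<delta> q0 w \<in> F})"

definition RPQ :: "'a list set \<Rightarrow> ('v, 'a) lgraph \<Rightarrow> bool" where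
  "RPQ L H \<longleftrightarrow>
     (\<exists>w\<in>L. \<exists>vs. length vs = Suc (length w) \<and> set vs \<subseteq> verts H \<and>
        (\<forall>i<length w. (vs ! i, vs ! Suc i) \<in> edges H \<and> lab H (vs ! i, vs ! Suc i) = w ! i))"

definition PQE :: "(('v, 'a) lgraph \<Rightarrow> bool) \<Rightarrow> ('v, 'a) lgraph \<Rightarrow> ('v \<times> 'v \<Rightarrow> rat) \<Rightarrow> rat" where
  "PQE Q H \<pi> = total_prob Q H \<pi>"

text \<open>Infixes are called sublists in the library.\<close>

definition infix_free :: "'a list set \<Rightarrow> 'a list set" where
  "infix_free L = {w \<in> L. \<not> (\<exists>u\<in>L. strict_sublist u w)}"

definition bounded_RPQ :: "'a list set \<Rightarrow> bool" where
  "bounded_RPQ L \<longleftrightarrow> finite (infix_free L)"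


section \<open>Polynomial-time computation on strings\<close>

text \<open>
  The machine model: finitely many stacks over a finite alphabet \<open>'c\<close>, operated by structured
  programs. Every elementary action touches one symbol and costs one time unit. Each stack can be
  kept on a tape of a multi-tape Turing machine and each tape can be kept on two stacks (one for
  each side of the head), so both models simulate each other with a constant-factor overhead.
  The head of a list is the top of the stack; a test reads the top symbol, which is \<open>None\<close> on the
  empty stack.
\<close>

datatype 'c prog =
    Skip
  | Push nat 'c
  | Pop nat
  | Seq "'c prog" "'c prog"
  | IfTop nat "'c option set" "'c prog" "'c prog"
  | WhileTop nat "'c option set" "'c prog"

type_synonym 'c store = "nat \<Rightarrow> 'c list"

definition top_of :: "'c list \<Rightarrow> 'c option" where
  "top_of xs = (case xs of [] \<Rightarrow> None | x # _ \<Rightarrow> Some x)"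

inductive exec :: "'c prog \<Rightarrow> 'c store \<Rightarrow> nat \<Rightarrow> 'c store \<Rightarrow> bool" where
  Skip: "exec Skip \<sigma> 1 \<sigma>"
| Push: "exec (Push k c) \<sigma> 1 (\<sigma>(k := c # \<sigma> k))"
| Pop: "exec (Pop k) \<sigma> 1 (\<sigma>(k := tl (\<sigma> k)))"
| Seq: "exec p \<sigma> m \<sigma>' \<Longrightarrow> exec q \<sigma>' n \<sigma>'' \<Longrightarrow> exec (Seq p q) \<sigma> (m + n) \<sigma>''"
| IfTrue: "top_of (\<sigma> k) \<in> C \<Longrightarrow> exec p \<sigma> n \<sigma>' \<Longrightarrow> exec (IfTop k C p q) \<sigma> (Suc n) \<sigma>'"
| IfFalse: "top_of (\<sigma> k) \<notin> C \<Longrightarrow> exec q \<sigma> n \<sigma>' \<Longrightarrow> exec (IfTop k C p q) \<sigma> (Suc n) \<sigma>'"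
| WhileFalse: "top_of (\<sigma> k) \<notin> C \<Longrightarrow> exec (WhileTop k C p) \<sigma> 1 \<sigma>"
| WhileTrue: "top_of (\<sigma> k) \<in> C \<Longrightarrow> exec p \<sigma> m \<sigma>' \<Longrightarrow> exec (WhileTop k C p) \<sigma>' n \<sigma>'' \<Longrightarrow>
    exec (WhileTop k C p) \<sigma> (Suc (m + n)) \<sigma>''"

inductive_cases exec_SkipE: "exec Skip \<sigma> n \<sigma>'"
inductive_cases exec_PushE: "exec (Push k c) \<sigma> n \<sigma>'"
inductive_cases exec_PopE: "exec (Pop k) \<sigma> n \<sigma>'"
inductive_cases exec_SeqE: "exec (Seq p q) \<sigma> n \<sigma>'"
inductive_cases exec_IfTopE: "exec (IfTop k C p q) \<sigma> n \<sigma>'"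
inductive_cases exec_WhileTopE: "exec (WhileTop k C p) \<sigma> n \<sigma>'"

lemma exec_deterministic:
  "exec p \<sigma> m \<sigma>1 \<Longrightarrow> exec p \<sigma> n \<sigma>2 \<Longrightarrow> m = n \<and> \<sigma>1 = \<sigma>2"
proof (induction arbitrary: n \<sigma>2 rule: exec.induct)
  case Skip
  then show ?case by (elim exec_SkipE) simp
next
  case Push
  then show ?case by (elim exec_PushE) simp
next
  case Pop
  then show ?case by (elim exec_PopE) simp
next
  case Seq
  from Seq.prems show ?case by (rule exec_SeqE) (use Seq.IH in blast)
next
  case IfTrue
  from IfTrue.prems show ?case by (rule exec_IfTopE) (use IfTrue.IH IfTrue.hyps in blast)+
next
  case IfFalse
  from IfFalse.prems show ?case by (rule exec_IfTopE) (use IfFalse.IH IfFalse.hyps in blast)+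
next
  case WhileFalse
  from WhileFalse.prems show ?case by (rule exec_WhileTopE) (use WhileFalse.hyps in simp_all)
next
  case WhileTrue
  from WhileTrue.prems show ?case
    by (rule exec_WhileTopE) (use WhileTrue.IH WhileTrue.hyps in blast)+
qed

text \<open>
  The input is on stack \<open>0\<close>, all other stacks are empty, and the output is read off stack \<open>1\<close>.
  Only inputs in \<open>D\<close> matter (the well-formed encodings of instances).
\<close>

definition init_store :: "'c list \<Rightarrow> 'c store" where
  "init_store w = (\<lambda>_. [])(0 := w)"

definition polytime_on :: "'c::finite list set \<Rightarrow> ('c list \<Rightarrow> 'c list) \<Rightarrow> bool" where
  "polytime_on D f \<longleftrightarrow>
     (\<exists>(P :: 'c prog) (p :: nat poly). \<forall>w\<in>D. \<exists>n \<sigma>.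
        exec P (init_store w) n \<sigma> \<and> \<sigma> 1 = f w \<and> n \<le> poly p (length w))"


section \<open>Encoding of instances as strings\<close>

datatype 'a sym = Zero | One | Sep | End | Letter 'a

instance sym :: (finite) finite
proof
  have "x \<in> {Zero, One, Sep, End} \<union> range Letter" for x :: "'a sym"
    by (cases x) auto
  then have "(UNIV :: 'a sym set) \<subseteq> {Zero, One, Sep, End} \<union> range Letter"
    by blast
  then show "finite (UNIV :: 'a sym set)"
    by (rule finite_subset) auto
qed

text \<open>Binary, least significant digit first and without superfluous zeros; \<open>0\<close> has no digits.\<close>

fun digits :: "nat \<Rightarrow> 'a sym list" where
  "digits n = (if n = 0 then [] else (if even n then Zero else One) # digits (n div 2))"

declare digits.simps [simp del]

definition enc_nat :: "nat \<Rightarrow> 'a sym list" where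
  "enc_nat n = digits n @ [Sep]"

text \<open>Numerator and denominator of the reduced fraction.\<close>

definition enc_prob :: "rat \<Rightarrow> 'a sym list" where
  "enc_prob r = enc_nat (nat (fst (quotient_of r))) @ enc_nat (nat (snd (quotient_of r)))"

text \<open>
  Vertices are named by natural numbers. The vertices and the edges are listed in an arbitrary
  order without repetition. The parameter \<open>el\<close> says how a label is written: as one letter for
  a graph over \<open>\<Sigma>\<close>, not at all for an unlabelled graph.
\<close>

definition enc_edge ::
  "('l \<Rightarrow> 'a sym list) \<Rightarrow> (nat, 'l) lgraph \<Rightarrow> (nat \<times> nat \<Rightarrow> rat) \<Rightarrow> nat \<times> nat \<Rightarrow> 'a sym list" where
  "enc_edge el H \<pi> e = enc_nat (fst e) @ enc_nat (snd e) @ el (lab H e) @ enc_prob (\<pi> e)"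

definition encodes_graph ::
  "('l \<Rightarrow> 'a sym list) \<Rightarrow> 'a sym list \<Rightarrow> (nat, 'l) lgraph \<Rightarrow> (nat \<times> nat \<Rightarrow> rat) \<Rightarrow> bool" where
  "encodes_graph el w H \<pi> \<longleftrightarrow>
     (\<exists>vs es. distinct vs \<and> set vs = verts H \<and> distinct es \<and> set es = edges H \<and>
        w = concat (map enc_nat vs) @ [End] @ concat (map (enc_edge el H \<pi>) es) @ [End])"

definition enc_vertex_pair :: "nat \<Rightarrow> nat \<Rightarrow> 'a sym list" where
  "enc_vertex_pair s t = enc_nat s @ enc_nat t"

definition encodes_stcon ::
  "'a sym list \<Rightarrow> (nat, unit) lgraph \<Rightarrow> (nat \<times> nat \<Rightarrow> rat) \<Rightarrow> nat \<Rightarrow> nat \<Rightarrow> bool" where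
  "encodes_stcon w H \<pi> s t \<longleftrightarrow>
     prob_graph H \<pi> \<and> s \<in> verts H \<and> t \<in> verts H \<and>
     (\<exists>w'. encodes_graph (\<lambda>_. []) w' H \<pi> \<and> w = w' @ enc_vertex_pair s t)"

definition encodes_pqe ::
  "'a sym list \<Rightarrow> (nat, 'a) lgraph \<Rightarrow> (nat \<times> nat \<Rightarrow> rat) \<Rightarrow> bool" where
  "encodes_pqe w H \<pi> \<longleftrightarrow> prob_graph H \<pi> \<and> encodes_graph (\<lambda>a. [Letter a]) w H \<pi>"

end

theory Submission imports Defs begin

text \<open>
  The infix-free sublanguage of \<open>L\<close> is saturated by a right congruence of finite index, so if it is
  infinite then pumping gives words \<open>x\<close>, \<open>y\<close>, \<open>z\<close> with \<open>y\<close> nonempty such that every \<open>x y\<^sup>n z\<close> is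
  infix-free in \<open>L\<close>; as \<open>x z\<close> and \<open>x y z\<close> are infix-free, \<open>x\<close> and \<open>z\<close> are nonempty. Replace every
  edge of \<open>H\<close> by a path labelled \<open>y\<close> whose last edge carries the probability of the edge, let a certain
  path labelled \<open>x\<close> enter \<open>s\<close>, and let a certain path labelled \<open>z\<close> leave \<open>t\<close>. Every walk reads an
  infix of some \<open>x y\<^sup>n z\<close>, and a strict one unless it goes from the first to the last vertex, hence
  through \<open>s\<close> and \<open>t\<close>; so the query holds exactly when \<open>t\<close> can be reached from \<open>s\<close>.

  A new vertex is named by a self-delimiting code of its position in the path and of the two ends of
  the edge. Such names are written by copying digits, so each edge takes time linear in its encoding.
\<close>

section \<open>Pumping infix-free words\<close>

text \<open>The values of \<open>h\<close> play the part of automaton states, so that no automaton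
  for \<open>I\<close> itself has to be built.\<close>

lemma right_congruence_pumping:
  fixes I :: "'a::finite list set" and h :: "'a list \<Rightarrow> 'q"
  assumes inf: "infinite I" and fin: "finite (range h)"
    and cong: "\<And>p p' a. h p = h p' \<Longrightarrow> h (p @ [a]) = h (p' @ [a])"
    and sat: "\<And>p p'. h p = h p' \<Longrightarrow> p \<in> I \<Longrightarrow> p' \<in> I"
  obtains x y z where "y \<noteq> []" "\<And>n. x @ concat (replicate n y) @ z \<in> I"
proof -
  have cong': "h (p @ r) = h (p' @ r)" if "h p = h p'" for p p' r
  proof (induction r rule: rev_induct)
    case (snoc a r)
    then show ?case using cong[of "p @ r" "p' @ r" a] by simp
  qed (use that in simp)
  define N where "N = card (range h)"
  \<comment> \<open>The alphabet is finite, so the infinite \<open>I\<close> has a word longer than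
    the number of classes; two of its prefixes then share a class.\<close>
  have "finite {w :: 'a list. length w \<le> N}"
    using finite_lists_length_le[of "UNIV :: 'a set" N] by simp
  with inf have "\<not> I \<subseteq> {w. length w \<le> N}"
    using finite_subset by blast
  then obtain w where w: "w \<in> I" "N < length w" by (auto simp: subset_iff not_le)
  have "\<not> inj_on (\<lambda>i. h (take i w)) {..length w}"
  proof
    assume "inj_on (\<lambda>i. h (take i w)) {..length w}"
    then have "card {..length w} \<le> card (range h)"
      by (rule card_inj_on_le) (use fin in auto)
    with w(2) show False by (simp add: N_def)
  qed
  then obtain i j where ij: "i < j" "j \<le> length w" "h (take i w) = h (take j w)"
    by (auto simp: inj_on_def) (metis linorder_neqE_nat)
  define x where "x = take i w"
  define y where "y = drop i (take j w)"
  define z where "z = drop j w"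
  have xy: "x @ y = take j w"
    unfolding x_def y_def using ij
    by (metis append_take_drop_id less_imp_le_nat min.absorb1 take_take)
  have "y \<noteq> []" using ij by (simp add: y_def)
  have hxy: "h (x @ concat (replicate n y)) = h (x @ y)" for n
  proof (induction n)
    case 0
    then show ?case using ij(3) xy by (simp add: x_def)
  next
    case (Suc n)
    have "h ((x @ concat (replicate n y)) @ y) = h (x @ y @ y)"
      using cong'[OF Suc, of y] by simp
    also have "\<dots> = h (x @ y)"
      using cong'[of "x @ y" x y] ij(3) xy by (simp add: x_def)
    moreover have "concat (replicate (Suc n) y) = concat (replicate n y) @ y"
      by (metis concat.simps concat_append replicate_append_same append_Nil2 replicate_Suc)
    ultimately show ?case by simp
  qed
  have "x @ y @ z = w" using xy by (metis append.assoc append_take_drop_id z_def)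
  then have "x @ concat (replicate n y) @ z \<in> I" for n
    using sat[of w "x @ concat (replicate n y) @ z"] w(1) cong'[OF hxy[of n], of z] by simp
  with \<open>y \<noteq> []\<close> that show ?thesis by blast
qed

section \<open>A right congruence for the infix-free sublanguage\<close>

lemma strict_suffix_snoc:
  "strict_suffix s (p @ [a]) \<longleftrightarrow> s = [] \<or> (\<exists>s'. s = s' @ [a] \<and> strict_suffix s' p)"
  by (cases s rule: rev_cases) (auto simp: strict_suffix_def suffix_def)

text \<open>An infix lying within \<open>p\<close> may be \<open>p\<close> itself, hence
  \<open>sublist\<close> on the right; any other one ends at the new letter.\<close>

lemma strict_sublist_snoc:
  "strict_sublist u (p @ [a]) \<longleftrightarrow> sublist u p \<or> strict_suffix u (p @ [a])"
  by (auto simp: strict_sublist_def strict_suffix_def sublist_snoc dest: sublist_length_le)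

lemma infix_free_pumping:
  fixes L :: "'a::finite list set"
  assumes reg: "regular_language L" and unb: "\<not> bounded_RPQ L"
  obtains x y z where "x \<noteq> []" "y \<noteq> []" "z \<noteq> []"
    "\<And>n. x @ concat (replicate n y) @ z \<in> infix_free L"
proof -
  from reg obtain S :: "nat set" and q0 F and \<delta> :: "nat \<Rightarrow> 'a \<Rightarrow> nat"
    where fin: "finite S" and q0: "q0 \<in> S" and \<delta>: "\<And>q a. q \<in> S \<Longrightarrow> \<delta> q a \<in> S"
      and L: "L = {w. foldl \<delta> q0 w \<in> F}"
    unfolding regular_language_def by blast
  \<comment> \<open>The class of \<open>p\<close> records the state after \<open>p\<close>, the
    states after its strict suffixes, and whether a strict infix of \<open>p\<close> lies in
    \<open>L\<close>. The first and the last decide membership in \<open>infix_free L\<close>; the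
    three together can be updated letter by letter.\<close>
  define suf where "suf p = foldl \<delta> q0 ` {s. strict_suffix s p}" for p
  define h where "h p = (foldl \<delta> q0 p, suf p, \<exists>u\<in>L. strict_sublist u p)" for p
  have run: "foldl \<delta> q0 p \<in> S" for p
    by (induction p rule: rev_induct) (use q0 \<delta> in auto)
  have "range h \<subseteq> S \<times> Pow S \<times> UNIV"
    using run by (auto simp: h_def suf_def)
  then have fin_h: "finite (range h)"
    by (rule finite_subset) (use fin in auto)
  have inf: "infinite (infix_free L)"
    using unb by (simp add: bounded_RPQ_def)
  have cong: "h (p @ [a]) = h (p' @ [a])" if eq: "h p = h p'" for p p' a
  proof -
    have suf_snoc: "suf (r @ [a]) = insert q0 ((\<lambda>q. \<delta> q a) ` suf r)" for r
    proof -
      have "{s. strict_suffix s (r @ [a])} = insert [] ((\<lambda>s. s @ [a]) ` {s. strict_suffix s r})"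
        by (auto simp: strict_suffix_snoc)
      then show ?thesis by (simp add: suf_def image_image)
    qed
    \<comment> \<open>A new strict infix in \<open>L\<close> is either the whole old word
      \<open>r\<close> or a strict suffix of the new word.\<close>
    have bad_snoc: "(\<exists>u\<in>L. strict_sublist u (r @ [a])) \<longleftrightarrow>
        (\<exists>u\<in>L. strict_sublist u r) \<or> foldl \<delta> q0 r \<in> F \<or> suf (r @ [a]) \<inter> F \<noteq> {}" for r
    proof -
      have "(\<exists>u\<in>L. strict_sublist u (r @ [a])) \<longleftrightarrow>
          (\<exists>u\<in>L. sublist u r) \<or> (\<exists>u\<in>L. strict_suffix u (r @ [a]))"
        by (auto simp: strict_sublist_snoc)
      moreover have "(\<exists>u\<in>L. sublist u r) \<longleftrightarrow> (\<exists>u\<in>L. strict_sublist u r) \<or> r \<in> L"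
        by (auto simp: strict_sublist_def)
      moreover have "(\<exists>u\<in>L. strict_suffix u (r @ [a])) \<longleftrightarrow> suf (r @ [a]) \<inter> F \<noteq> {}"
        by (auto simp: suf_def L)
      ultimately show ?thesis by (simp add: L)
    qed
    show ?thesis using eq by (simp add: h_def suf_snoc bad_snoc)
  qed
  have sat: "p' \<in> infix_free L" if "h p = h p'" "p \<in> infix_free L" for p p'
    using that by (auto simp: h_def infix_free_def L)
  obtain x y z where y: "y \<noteq> []"
    and mem: "\<And>n. x @ concat (replicate n y) @ z \<in> infix_free L"
  proof (rule right_congruence_pumping[OF inf fin_h])
    show "h (p @ [a]) = h (p' @ [a])" if "h p = h p'" for p p' a
      using that by (rule cong)
    show "p' \<in> infix_free L" if "h p = h p'" "p \<in> infix_free L" for p p'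
      using that by (rule sat)
  qed blast
  have xz: "x @ z \<in> L" and xyz: "x @ y @ z \<in> infix_free L"
    using mem[of 0] mem[of 1] by (auto simp: infix_free_def)
  \<comment> \<open>With \<open>x\<close> or \<open>z\<close> empty, \<open>x @ z\<close> would be a
    suffix or a prefix of \<open>x @ y @ z\<close>, and a strict one because \<open>y\<close> is
    nonempty.\<close>
  have "\<not> strict_sublist (x @ z) (x @ y @ z)"
    using xz xyz by (auto simp: infix_free_def)
  then have "x \<noteq> []" "z \<noteq> []"
    using y by (auto simp: strict_sublist_def)
  with y mem that show ?thesis by blast
qed

section \<open>Probabilities, paths and walks\<close>

text \<open>A subgraph of \<open>H'\<close> lacking a certain edge has probability 0. Every other
  one consists of \<open>C\<close> and the image of a subgraph of \<open>H\<close>, with the same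
  probability and the same answer to the query.\<close>

lemma total_prob_embed:
  fixes H :: "('v, 'a) lgraph" and H' :: "('w, 'b) lgraph"
  assumes fin: "finite (edges H)" "finite C"
    and edges: "edges H' = C \<union> \<iota> ` edges H" "C \<inter> \<iota> ` edges H = {}"
    and inj: "inj_on \<iota> (edges H)"
    and certain: "\<And>e. e \<in> C \<Longrightarrow> \<pi>' e = 1"
    and prob: "\<And>e. e \<in> edges H \<Longrightarrow> \<pi>' (\<iota> e) = \<pi> e"
    and query: "\<And>E. E \<subseteq> edges H \<Longrightarrow>
      Q' (H'\<lparr>edges := C \<union> \<iota> ` E\<rparr>) \<longleftrightarrow> Q (H\<lparr>edges := E\<rparr>)"
  shows "total_prob Q' H' \<pi>' = total_prob Q H \<pi>"
proof -
  define S where "S = {E. E \<subseteq> edges H \<and> Q (H\<lparr>edges := E\<rparr>)}"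
  define S' where "S' = {E. E \<subseteq> edges H' \<and> Q' (H'\<lparr>edges := E\<rparr>)}"
  define m where "m E = C \<union> \<iota> ` E" for E
  have fin': "finite (edges H')" using fin edges by simp
  have m_inj: "inj_on m S"
  proof (rule inj_onI)
    fix A B assume AB: "A \<in> S" "B \<in> S" "m A = m B"
    then have "\<iota> ` A = m A - C" "\<iota> ` B = m B - C"
      using edges(2) unfolding m_def S_def by blast+
    with AB have "\<iota> ` A = \<iota> ` B" by simp
    with AB inj show "A = B" by (auto simp: S_def inj_on_image_eq_iff)
  qed
  have "sum (subgraph_prob H' \<pi>') (m ` S) = sum (subgraph_prob H' \<pi>') S'"
  proof (rule sum.mono_neutral_left)
    show "finite S'" using fin' by (auto simp: S'_def)
    show "m ` S \<subseteq> S'" using query edges(1) by (auto simp: S_def S'_def m_def)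
    show "\<forall>E\<in>S' - m ` S. subgraph_prob H' \<pi>' E = 0"
    proof
      fix E assume E: "E \<in> S' - m ` S"
      \<comment> \<open>Otherwise \<open>E\<close> would be the value of \<open>m\<close> at the set
        of edges whose images it contains.\<close>
      have "\<not> C \<subseteq> E"
      proof
        assume "C \<subseteq> E"
        then have "E = m {e \<in> edges H. \<iota> e \<in> E}"
          using E edges(1) by (auto simp: m_def S'_def)
        moreover from this have "{e \<in> edges H. \<iota> e \<in> E} \<in> S"
          using E query[of "{e \<in> edges H. \<iota> e \<in> E}"] by (auto simp: S_def S'_def m_def)
        ultimately show False using E by blast
      qed
      then obtain e where e: "e \<in> C" "e \<notin> E" by blast
      have "e \<in> edges H' - E" "1 - \<pi>' e = 0"
        using e edges(1) certain[OF e(1)] by simp_all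
      then have "(\<Prod>e\<in>edges H' - E. 1 - \<pi>' e) = 0"
        using fin' by (intro prod_zero) blast+
      then show "subgraph_prob H' \<pi>' E = 0" by (simp add: subgraph_prob_def)
    qed
  qed
  moreover have "subgraph_prob H' \<pi>' (m E) = subgraph_prob H \<pi> E" if "E \<in> S" for E
  proof -
    have E: "E \<subseteq> edges H" using that by (simp add: S_def)
    have "prod \<pi>' (m E) = prod \<pi>' C * prod \<pi>' (\<iota> ` E)"
      unfolding m_def using fin E edges(2)
      by (intro prod.union_disjoint) (auto intro: finite_subset)
    also have "prod \<pi>' (\<iota> ` E) = prod \<pi> E"
      using inj E prob by (subst prod.reindex) (auto intro!: prod.cong intro: inj_on_subset)
    finally have "prod \<pi>' (m E) = prod \<pi> E" using certain by simp
    moreover have "edges H' - m E = \<iota> ` (edges H - E)"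
      using edges E inj_on_image_set_diff[OF inj, of "edges H" E] by (auto simp: m_def)
    moreover have "(\<Prod>e\<in>\<iota> ` (edges H - E). 1 - \<pi>' e) = (\<Prod>e\<in>edges H - E. 1 - \<pi> e)"
      using inj prob by (subst prod.reindex) (auto intro!: prod.cong intro: inj_on_subset)
    ultimately show ?thesis by (simp add: subgraph_prob_def)
  qed
  ultimately show ?thesis
    unfolding total_prob_def S_def[symmetric] S'_def[symmetric]
    by (subst (asm) sum.reindex[OF m_inj]) (simp add: o_def)
qed

section \<open>Directed paths and labelled walks\<close>

lemma has_dipath_iff_rtrancl:
  assumes "s \<in> verts H" "edges H \<subseteq> verts H \<times> verts H"
  shows "has_dipath s t H \<longleftrightarrow> (s, t) \<in> (edges H)\<^sup>*"
proof
  assume "has_dipath s t H"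
  then obtain p where p: "p \<noteq> []" "hd p = s" "last p = t"
    "\<And>i. Suc i < length p \<Longrightarrow> (p ! i, p ! Suc i) \<in> edges H"
    unfolding has_dipath_def by blast
  have "(p ! 0, p ! i) \<in> (edges H)\<^sup>*" if "i < length p" for i
    using that by (induction i) (auto intro: rtrancl_into_rtrancl p(4))
  from this[of "length p - 1"] p show "(s, t) \<in> (edges H)\<^sup>*"
    by (simp add: hd_conv_nth last_conv_nth)
next
  assume st: "(s, t) \<in> (edges H)\<^sup>*"
  then have "t \<in> verts H" using assms by (induction) auto
  from st show "has_dipath s t H"
  proof (induction rule: converse_rtrancl_induct)
    case base
    then show ?case using \<open>t \<in> verts H\<close> by (auto simp: has_dipath_def intro!: exI[of _ "[t]"])
  next
    case (step u v)
    then obtain p where p: "p \<noteq> []" "distinct p" "set p \<subseteq> verts H" "hd p = v" "last p = t"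
      "\<And>i. Suc i < length p \<Longrightarrow> (p ! i, p ! Suc i) \<in> edges H"
      unfolding has_dipath_def by blast
    show ?case
    proof (cases "u \<in> set p")
      \<comment> \<open>\<open>u\<close> closes a cycle with the path found so far; the part of that
        path starting at \<open>u\<close> is again simple.\<close>
      case True
      then obtain as bs where "p = as @ u # bs" by (auto simp: in_set_conv_decomp)
      moreover have "((u # bs) ! i, (u # bs) ! Suc i) \<in> edges H" if "Suc i < length (u # bs)" for i
        using p(6)[of "length as + i"] that calculation by (simp add: nth_append)
      ultimately show ?thesis
        using p unfolding has_dipath_def by (intro exI[of _ "u # bs"]) auto
    next
      case False
      have "((u # p) ! i, (u # p) ! Suc i) \<in> edges H" if "Suc i < length (u # p)" for i
        using that p(1,4,6) step(1) by (cases i) (auto simp: hd_conv_nth)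
      with False p step(1) assms(2) show ?thesis
        unfolding has_dipath_def by (intro exI[of _ "u # p"]) auto
    qed
  qed
qed

text \<open>A recursive form of the vertex list in \<open>RPQ\<close> with both ends visible, so
  that walks can be concatenated and traced by induction on the word.\<close>

fun lwalk :: "('v, 'a) lgraph \<Rightarrow> 'v \<Rightarrow> 'a list \<Rightarrow> 'v \<Rightarrow> bool" where
  "lwalk G u [] v \<longleftrightarrow> u = v \<and> u \<in> verts G"
| "lwalk G u (a # w) v \<longleftrightarrow>
     u \<in> verts G \<and> (\<exists>u'. (u, u') \<in> edges G \<and> lab G (u, u') = a \<and> lwalk G u' w v)"

lemma lwalk_append: "lwalk G u w v \<Longrightarrow> lwalk G v w' v' \<Longrightarrow> lwalk G u (w @ w') v'"
  by (induction w arbitrary: u) auto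

lemma lwalk_iff_nth:
  "lwalk G u w v \<longleftrightarrow> (\<exists>vs. length vs = Suc (length w) \<and> set vs \<subseteq> verts G \<and> vs ! 0 = u \<and>
     vs ! length w = v \<and>
     (\<forall>i<length w. (vs ! i, vs ! Suc i) \<in> edges G \<and> lab G (vs ! i, vs ! Suc i) = w ! i))"
proof (induction w arbitrary: u)
  case Nil
  show ?case by (auto simp: length_Suc_conv intro: exI[of _ "[v]"])
next
  case (Cons a w)
  show ?case
  proof
    assume "lwalk G u (a # w) v"
    then obtain u' vs where "u \<in> verts G" "(u, u') \<in> edges G" "lab G (u, u') = a"
      "length vs = Suc (length w)" "set vs \<subseteq> verts G" "vs ! 0 = u'" "vs ! length w = v"
      "\<forall>i<length w. (vs ! i, vs ! Suc i) \<in> edges G \<and> lab G (vs ! i, vs ! Suc i) = w ! i"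
      using Cons.IH by auto
    then show "\<exists>vs. length vs = Suc (length (a # w)) \<and> set vs \<subseteq> verts G \<and> vs ! 0 = u \<and>
      vs ! length (a # w) = v \<and> (\<forall>i<length (a # w). (vs ! i, vs ! Suc i) \<in> edges G \<and>
        lab G (vs ! i, vs ! Suc i) = (a # w) ! i)"
      by (intro exI[of _ "u # vs"]) (auto simp: nth_Cons' less_Suc_eq_0_disj)
  next
    assume "\<exists>vs. length vs = Suc (length (a # w)) \<and> set vs \<subseteq> verts G \<and> vs ! 0 = u \<and>
      vs ! length (a # w) = v \<and> (\<forall>i<length (a # w). (vs ! i, vs ! Suc i) \<in> edges G \<and>
        lab G (vs ! i, vs ! Suc i) = (a # w) ! i)"
    then obtain vs where vs: "length vs = Suc (Suc (length w))" "set vs \<subseteq> verts G" "vs ! 0 = u"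
      "vs ! Suc (length w) = v" "\<And>i. i < Suc (length w) \<Longrightarrow> (vs ! i, vs ! Suc i) \<in> edges G \<and>
        lab G (vs ! i, vs ! Suc i) = (a # w) ! i"
      by auto
    from vs(1) obtain vs' where vs': "vs = u # vs'" "length vs' = Suc (length w)"
      using vs(3) by (auto simp: length_Suc_conv)
    have "lwalk G (vs' ! 0) w v"
      unfolding Cons.IH using vs vs' vs(5)[of "Suc _"] by (intro exI[of _ vs']) auto
    then show "lwalk G u (a # w) v"
      using vs(2) vs(5)[of 0] vs' by auto
  qed
qed

lemma RPQ_iff_lwalk: "RPQ L G \<longleftrightarrow> (\<exists>w\<in>L. \<exists>u v. lwalk G u w v)"
  unfolding RPQ_def lwalk_iff_nth by metis

section \<open>Stack programs\<close>

text \<open>\<open>exec\<close> counts time exactly; with an upper bound instead, costs can be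
  rounded before they are added.\<close>

definition runs :: "'c prog \<Rightarrow> 'c store \<Rightarrow> nat \<Rightarrow> 'c store \<Rightarrow> bool" where
  "runs p \<sigma> N \<sigma>' \<longleftrightarrow> (\<exists>n\<le>N. exec p \<sigma> n \<sigma>')"

lemma runs_mono: "runs p \<sigma> m \<sigma>' \<Longrightarrow> m \<le> n \<Longrightarrow> runs p \<sigma> n \<sigma>'"
  unfolding runs_def using le_trans by blast

lemma runsI: "exec p \<sigma> n \<sigma>' \<Longrightarrow> runs p \<sigma> n \<sigma>'"
  by (auto simp: runs_def)

lemma runs_Skip: "runs Skip \<sigma> 1 \<sigma>"
  by (rule runsI[OF exec.Skip])

lemma runs_Push: "runs (Push k c) \<sigma> 1 (\<sigma>(k := c # \<sigma> k))"
  by (rule runsI[OF exec.Push])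

lemma runs_Pop: "runs (Pop k) \<sigma> 1 (\<sigma>(k := tl (\<sigma> k)))"
  by (rule runsI[OF exec.Pop])

lemma runs_Seq: "runs p \<sigma> m \<sigma>' \<Longrightarrow> runs q \<sigma>' n \<sigma>'' \<Longrightarrow> runs (Seq p q) \<sigma> (m + n) \<sigma>''"
  unfolding runs_def by (meson add_mono exec.Seq)

lemma runs_WhileFalse: "top_of (\<sigma> k) \<notin> C \<Longrightarrow> runs (WhileTop k C p) \<sigma> 1 \<sigma>"
  by (rule runsI[OF exec.WhileFalse])

lemma runs_WhileTrue:
  assumes "top_of (\<sigma> k) \<in> C" "runs p \<sigma> m \<sigma>'" "runs (WhileTop k C p) \<sigma>' n \<sigma>''"
  shows "runs (WhileTop k C p) \<sigma> (Suc (m + n)) \<sigma>''"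
proof -
  from assms(2,3) obtain m' n' where "m' \<le> m" "n' \<le> n"
    "exec p \<sigma> m' \<sigma>'" "exec (WhileTop k C p) \<sigma>' n' \<sigma>''"
    by (auto simp: runs_def)
  with exec.WhileTrue[of \<sigma> k C p m' \<sigma>' n' \<sigma>''] assms(1) show ?thesis
    unfolding runs_def by (intro exI[of _ "Suc (m' + n')"]) simp
qed

lemma runs_IfTrue:
  "top_of (\<sigma> k) \<in> C \<Longrightarrow> runs p \<sigma> n \<sigma>' \<Longrightarrow> runs (IfTop k C p q) \<sigma> (Suc n) \<sigma>'"
  unfolding runs_def by (meson Suc_le_mono exec.IfTrue)

lemma runs_IfFalse:
  "top_of (\<sigma> k) \<notin> C \<Longrightarrow> runs q \<sigma> n \<sigma>' \<Longrightarrow> runs (IfTop k C p q) \<sigma> (Suc n) \<sigma>'"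
  unfolding runs_def by (meson Suc_le_mono exec.IfFalse)

text \<open>One step pushes at most one symbol. This bounds the text collected on stacks
  \<open>2\<close> and \<open>3\<close>, and so the time of the final transfer.\<close>

lemma exec_length: "exec p \<sigma> n \<sigma>' \<Longrightarrow> length (\<sigma>' k) \<le> length (\<sigma> k) + n"
  by (induction rule: exec.induct) auto

lemma runs_length: "runs p \<sigma> n \<sigma>' \<Longrightarrow> length (\<sigma>' k) \<le> length (\<sigma> k) + n"
  unfolding runs_def using exec_length by (meson add_left_mono le_trans)

section \<open>Writing constants and moving symbols between stacks\<close>

fun pushes :: "(nat \<times> 'c) list \<Rightarrow> 'c prog" where
  "pushes [] = Skip"
| "pushes (q # qs) = Seq (Push (fst q) (snd q)) (pushes qs)"

definition pushed_to :: "nat \<Rightarrow> (nat \<times> 'c) list \<Rightarrow> 'c list" where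
  "pushed_to k qs = map snd (filter (\<lambda>q. fst q = k) qs)"

lemma pushed_to_simps [simp]:
  "pushed_to k [] = []"
  "pushed_to k (q # qs) = (if fst q = k then [snd q] else []) @ pushed_to k qs"
  by (auto simp: pushed_to_def)

lemma runs_pushes: "runs (pushes qs) \<sigma> (Suc (length qs)) (\<lambda>k. rev (pushed_to k qs) @ \<sigma> k)"
proof (induction qs arbitrary: \<sigma>)
  case Nil
  show ?case using runs_Skip[of \<sigma>] by simp
next
  case (Cons q qs)
  let ?\<sigma> = "\<sigma>(fst q := snd q # \<sigma> (fst q))"
  have "(\<lambda>k. rev (pushed_to k qs) @ ?\<sigma> k) = (\<lambda>k. rev (pushed_to k (q # qs)) @ \<sigma> k)"
    by auto
  with runs_Seq[OF runs_Push Cons.IH[of ?\<sigma>]] show ?case by simp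
qed

text \<open>A test tells only whether the top lies in a set; a chain of singleton tests recovers the
  symbol, which selects what to push.\<close>

fun case_top :: "nat \<Rightarrow> 'c list \<Rightarrow> ('c \<Rightarrow> (nat \<times> 'c) list) \<Rightarrow> 'c prog" where
  "case_top A [] g = Skip"
| "case_top A (c # cs) g = IfTop A {Some c} (Seq (Pop A) (pushes (g c))) (case_top A cs g)"

definition transfer :: "nat \<Rightarrow> 'c list \<Rightarrow> ('c \<Rightarrow> (nat \<times> 'c) list) \<Rightarrow> 'c prog" where
  "transfer A cs g = WhileTop A (Some ` set cs) (case_top A cs g)"

lemma top_of_simps [simp]: "top_of [] = None" "top_of (c # r) = Some c"
  by (simp_all add: top_of_def)

lemma runs_case_top:
  assumes "\<sigma> A = c # r" "c \<in> set cs"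
  shows "runs (case_top A cs g) \<sigma> (length cs + length (g c) + 2)
    (\<lambda>k. rev (pushed_to k (g c)) @ (\<sigma>(A := r)) k)"
  using assms(2)
proof (induction cs)
  case (Cons d cs)
  show ?case
  proof (cases "c = d")
    case True
    have "runs (Seq (Pop A) (pushes (g c))) \<sigma> (1 + Suc (length (g c)))
        (\<lambda>k. rev (pushed_to k (g c)) @ (\<sigma>(A := r)) k)"
      by (rule runs_Seq[OF runs_Pop]) (use runs_pushes[of "g c" "\<sigma>(A := r)"] assms(1) in simp)
    then have "runs (case_top A (d # cs) g) \<sigma> (Suc (1 + Suc (length (g c))))
        (\<lambda>k. rev (pushed_to k (g c)) @ (\<sigma>(A := r)) k)"
      using True assms(1) by (simp add: runs_IfTrue)
    then show ?thesis by (rule runs_mono) simp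
  next
    case False
    with Cons show ?thesis using assms(1) by (simp add: runs_IfFalse)
  qed
qed simp

text \<open>As \<open>g\<close> pushes nothing on \<open>A\<close>, every round shortens
  \<open>A\<close> by one symbol. A round takes at most \<open>length cs + m + 2\<close> steps for
  the case distinction and one for the loop test.\<close>

lemma runs_transfer:
  assumes "\<sigma> A = xs @ r" "set xs \<subseteq> set cs" "top_of r \<notin> Some ` set cs"
    and "\<And>c. c \<in> set cs \<Longrightarrow> pushed_to A (g c) = [] \<and> length (g c) \<le> m"
  shows "runs (transfer A cs g) \<sigma> ((length cs + m + 3) * length xs + 1)
    (\<lambda>k. rev (concat (map (\<lambda>c. pushed_to k (g c)) xs)) @ (\<sigma>(A := r)) k)"
  using assms(1,2)
proof (induction xs arbitrary: \<sigma>)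
  case Nil
  then have "\<sigma>(A := r) = \<sigma>" by auto
  with Nil show ?case
    using assms(3) unfolding transfer_def by (simp add: runs_WhileFalse[simplified])
next
  case (Cons c xs)
  let ?\<sigma> = "\<lambda>k. rev (pushed_to k (g c)) @ (\<sigma>(A := xs @ r)) k"
  have c: "c \<in> set cs" using Cons.prems by simp
  have "runs (case_top A cs g) \<sigma> (length cs + length (g c) + 2) ?\<sigma>"
    using Cons.prems c by (intro runs_case_top) auto
  moreover have "?\<sigma> A = xs @ r" using assms(4)[OF c] by simp
  then have "runs (transfer A cs g) ?\<sigma> ((length cs + m + 3) * length xs + 1)
      (\<lambda>k. rev (concat (map (\<lambda>c. pushed_to k (g c)) xs)) @ (?\<sigma>(A := r)) k)"
    using Cons by simp
  ultimately have "runs (transfer A cs g) \<sigma>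
      (Suc (length cs + length (g c) + 2 + ((length cs + m + 3) * length xs + 1)))
      (\<lambda>k. rev (concat (map (\<lambda>c. pushed_to k (g c)) xs)) @ (?\<sigma>(A := r)) k)"
    using Cons.prems(1) c unfolding transfer_def by (intro runs_WhileTrue) auto
  moreover have "(\<lambda>k. rev (concat (map (\<lambda>c. pushed_to k (g c)) xs)) @ (?\<sigma>(A := r)) k) =
      (\<lambda>k. rev (concat (map (\<lambda>c. pushed_to k (g c)) (c # xs))) @ (\<sigma>(A := r)) k)"
    using assms(4)[OF c] by auto
  ultimately show ?case
    using assms(4)[OF c] by (auto elim!: runs_mono)
qed

section \<open>Numbers on stacks\<close>

lemma set_digits: "set (digits n :: 'a sym list) \<subseteq> {Zero, One}"
  by (induction n rule: digits.induct) (subst digits.simps, auto)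

abbreviation bit_syms :: "'a sym list" where
  "bit_syms \<equiv> [Zero, One]"

text \<open>A token is kept on a stack most significant digit on top, as it is read off stack \<open>0\<close>.\<close>

definition read_token :: "nat \<Rightarrow> 'a sym prog" where
  "read_token A = Seq (transfer 0 bit_syms (\<lambda>c. [(A, c)])) (Pop 0)"

text \<open>Reading reverses the digits, which is the orientation of an output stack; the separator
  consumed by reading is written again.\<close>

definition copy_token :: "nat \<Rightarrow> 'a sym prog" where
  "copy_token B = Seq (read_token B) (Push B Sep)"

definition clear_token :: "nat \<Rightarrow> 'a sym prog" where
  "clear_token A = transfer A bit_syms (\<lambda>c. [])"

lemma concat_map_singleton: "concat (map (\<lambda>c. [c]) xs) = xs"
  by (induction xs) auto

lemma runs_move:
  assumes "\<sigma> A = xs @ r" "set xs \<subseteq> set cs" "top_of r \<notin> Some ` set cs" "A \<noteq> B"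
  shows "runs (transfer A cs (\<lambda>c. [(B, c)])) \<sigma> ((length cs + 4) * length xs + 1)
    (\<sigma>(A := r, B := rev xs @ \<sigma> B))"
proof -
  have "runs (transfer A cs (\<lambda>c. [(B, c)])) \<sigma> ((length cs + 1 + 3) * length xs + 1)
      (\<lambda>k. rev (concat (map (\<lambda>c. pushed_to k [(B, c)]) xs)) @ (\<sigma>(A := r)) k)"
    using assms by (intro runs_transfer) auto
  moreover have "(\<lambda>k. rev (concat (map (\<lambda>c. pushed_to k [(B, c)]) xs)) @ (\<sigma>(A := r)) k) =
      \<sigma>(A := r, B := rev xs @ \<sigma> B)"
    using assms(4) by (auto simp: concat_map_singleton)
  ultimately have "runs (transfer A cs (\<lambda>c. [(B, c)])) \<sigma> ((length cs + 1 + 3) * length xs + 1)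
      (\<sigma>(A := r, B := rev xs @ \<sigma> B))"
    by simp
  then show ?thesis by (rule runs_mono) simp
qed

lemma runs_read_token:
  fixes \<sigma> :: "'a sym store"
  assumes "\<sigma> 0 = enc_nat n @ r" "B \<noteq> 0"
  shows "runs (read_token B) \<sigma> (7 * length (enc_nat n :: 'a sym list))
    (\<sigma>(0 := r, B := rev (digits n) @ \<sigma> B))"
proof -
  have "runs (transfer 0 bit_syms (\<lambda>c. [(B, c)])) \<sigma>
      ((length (bit_syms :: 'a sym list) + 4) * length (digits n :: 'a sym list) + 1)
      (\<sigma>(0 := Sep # r, B := rev (digits n) @ \<sigma> B))"
    using assms set_digits[of n] by (intro runs_move) (auto simp: enc_nat_def)
  from runs_Seq[OF this runs_Pop[of 0]] have "runs (read_token B) \<sigma>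
      ((length (bit_syms :: 'a sym list) + 4) * length (digits n :: 'a sym list) + 1 + 1)
      (\<sigma>(0 := r, B := rev (digits n) @ \<sigma> B))"
    using assms(2) by (simp add: read_token_def fun_upd_twist)
  then show ?thesis by (rule runs_mono) (simp add: enc_nat_def)
qed

lemma runs_copy_token:
  fixes \<sigma> :: "'a sym store"
  assumes "\<sigma> 0 = enc_nat n @ r" "B \<noteq> 0"
  shows "runs (copy_token B) \<sigma> (8 * length (enc_nat n :: 'a sym list))
    (\<sigma>(0 := r, B := rev (enc_nat n) @ \<sigma> B))"
proof -
  have "runs (copy_token B) \<sigma> (7 * length (enc_nat n :: 'a sym list) + 1)
      (\<sigma>(0 := r, B := rev (enc_nat n) @ \<sigma> B))"
    using runs_Seq[OF runs_read_token[of \<sigma> n r B, OF assms] runs_Push[of B Sep]] assms(2)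
    by (simp add: copy_token_def enc_nat_def)
  then show ?thesis by (rule runs_mono) (simp add: enc_nat_def)
qed

lemma runs_clear_token:
  fixes \<sigma> :: "'a sym store"
  assumes "set (\<sigma> A) \<subseteq> {Zero, One}"
  shows "runs (clear_token A) \<sigma> (5 * length (\<sigma> A) + 1) (\<sigma>(A := []))"
proof -
  have "runs (clear_token A) \<sigma> ((length (bit_syms :: 'a sym list) + 0 + 3) * length (\<sigma> A) + 1)
      (\<lambda>k. rev (concat (map (\<lambda>c. pushed_to k []) (\<sigma> A))) @ (\<sigma>(A := [])) k)"
    unfolding clear_token_def using assms by (intro runs_transfer) auto
  moreover have "(\<lambda>k. rev (concat (map (\<lambda>c. pushed_to k []) (\<sigma> A))) @ (\<sigma>(A := [])) k) = \<sigma>(A := [])"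
    by auto
  ultimately show ?thesis by simp
qed

section \<open>Writing text from templates\<close>

text \<open>A template describes a string to be written; \<open>Token A\<close> stands for the digits kept on stack
  \<open>A\<close>, each preceded by the digit \<open>One\<close> so that a following \<open>Zero\<close> ends them. Stack \<open>6\<close> is scratch.\<close>

datatype 'a item = Const "'a sym list" | Token nat

fun text_of :: "'a sym store \<Rightarrow> 'a item \<Rightarrow> 'a sym list" where
  "text_of \<sigma> (Const xs) = xs"
| "text_of \<sigma> (Token A) = concat (map (\<lambda>c. [One, c]) (rev (\<sigma> A)))"

text \<open>Reading a token empties its stack, so its digits go to stack \<open>6\<close> and are
  both restored and written on the way back. The detour also brings the least significant digit
  first.\<close>

fun emit_item :: "nat \<Rightarrow> 'a item \<Rightarrow> 'a sym prog" where
  "emit_item B (Const xs) = pushes (map (Pair B) xs)"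
| "emit_item B (Token A) = Seq (transfer A bit_syms (\<lambda>c. [(6, c)]))
     (transfer 6 bit_syms (\<lambda>c. [(A, c), (B, One), (B, c)]))"

fun emit :: "nat \<Rightarrow> 'a item list \<Rightarrow> 'a sym prog" where
  "emit B [] = Skip"
| "emit B (i # ts) = Seq (emit_item B i) (emit B ts)"

text \<open>\<open>14\<close> counts the steps per digit of a token: six on the way to stack
  \<open>6\<close> and eight on the way back.\<close>

fun item_cost :: "'a item \<Rightarrow> nat" where
  "item_cost (Const xs) = Suc (length xs)"
| "item_cost (Token A) = 14"

definition emit_cost :: "'a item list \<Rightarrow> nat" where
  "emit_cost ts = Suc (sum_list (map item_cost ts))"

text \<open>One bound \<open>N\<close> for all tokens makes the cost of a template a constant times
  \<open>N\<close>; its strictness leaves room for the steps that do not depend on the length of a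
  token.\<close>

definition tokens_ok :: "nat \<Rightarrow> 'a sym store \<Rightarrow> 'a item list \<Rightarrow> nat \<Rightarrow> bool" where
  "tokens_ok B \<sigma> ts N \<longleftrightarrow> B \<noteq> 6 \<and> \<sigma> 6 = [] \<and> N \<noteq> 0 \<and>
     (\<forall>A. Token A \<in> set ts \<longrightarrow> A \<noteq> B \<and> A \<noteq> 6 \<and> set (\<sigma> A) \<subseteq> {Zero, One} \<and> length (\<sigma> A) < N)"

lemma pushed_to_map_Pair: "pushed_to k (map (Pair B) xs) = (if k = B then xs else [])"
  by (induction xs) auto

lemma runs_emit_item:
  assumes ok: "tokens_ok B \<sigma> [i] N"
  shows "runs (emit_item B i) \<sigma> (item_cost i * N) (\<sigma>(B := rev (text_of \<sigma> i) @ \<sigma> B))"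
proof (cases i)
  case (Const xs)
  have "(\<lambda>k. rev (pushed_to k (map (Pair B) xs)) @ \<sigma> k) = \<sigma>(B := rev xs @ \<sigma> B)"
    by (auto simp: pushed_to_map_Pair)
  with runs_pushes[of "map (Pair B) xs" \<sigma>]
  have "runs (emit_item B i) \<sigma> (Suc (length xs)) (\<sigma>(B := rev xs @ \<sigma> B))"
    using Const by simp
  moreover have "Suc (length xs) \<le> Suc (length xs) * N"
    using ok mult_le_mono2[of 1 N "Suc (length xs)"] by (simp add: tokens_ok_def)
  ultimately show ?thesis using Const by (auto elim: runs_mono)
next
  case (Token A)
  with ok have A: "A \<noteq> B" "A \<noteq> 6" "B \<noteq> 6" "set (\<sigma> A) \<subseteq> {Zero, One}" "length (\<sigma> A) < N" "\<sigma> 6 = []"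
    by (auto simp: tokens_ok_def)
  let ?\<tau> = "\<sigma>(A := [], 6 := rev (\<sigma> A))"
  have 1: "runs (transfer A bit_syms (\<lambda>c. [(6, c)])) \<sigma>
      ((length (bit_syms :: 'a sym list) + 4) * length (\<sigma> A) + 1) ?\<tau>"
    using runs_move[of \<sigma> A "\<sigma> A" "[]" bit_syms 6] A by simp
  have 2: "runs (transfer 6 bit_syms (\<lambda>c. [(A, c), (B, One), (B, c)])) ?\<tau>
      ((length (bit_syms :: 'a sym list) + 3 + 3) * length (rev (\<sigma> A)) + 1)
      (\<lambda>k. rev (concat (map (\<lambda>c. pushed_to k [(A, c), (B, One), (B, c)]) (rev (\<sigma> A)))) @
        (?\<tau>(6 := [])) k)"
    using A by (intro runs_transfer) auto
  have "(\<lambda>k. rev (concat (map (\<lambda>c. pushed_to k [(A, c), (B, One), (B, c)]) (rev (\<sigma> A)))) @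
        (?\<tau>(6 := [])) k) = \<sigma>(B := rev (text_of \<sigma> i) @ \<sigma> B)"
    using A Token by (auto simp: concat_map_singleton)
  with runs_Seq[OF 1 2] have "runs (emit_item B i) \<sigma> (14 * length (\<sigma> A) + 2)
      (\<sigma>(B := rev (text_of \<sigma> i) @ \<sigma> B))"
    using Token by simp
  then show ?thesis by (rule runs_mono) (use A Token in simp)
qed

lemma runs_emit:
  assumes "tokens_ok B \<sigma> ts N"
  shows "runs (emit B ts) \<sigma> (emit_cost ts * N) (\<sigma>(B := rev (concat (map (text_of \<sigma>) ts)) @ \<sigma> B))"
  using assms
proof (induction ts arbitrary: \<sigma>)
  case Nil
  then show ?case using runs_Skip[of \<sigma>] by (auto simp: tokens_ok_def emit_cost_def elim: runs_mono)
next
  case (Cons i ts)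
  let ?\<sigma> = "\<sigma>(B := rev (text_of \<sigma> i) @ \<sigma> B)"
  have "text_of ?\<sigma> j = text_of \<sigma> j" if "j \<in> set ts" for j
    using Cons.prems that by (cases j) (auto simp: tokens_ok_def)
  then have text_eq: "map (text_of ?\<sigma>) ts = map (text_of \<sigma>) ts" by simp
  have "runs (emit_item B i) \<sigma> (item_cost i * N) ?\<sigma>"
    using Cons.prems by (intro runs_emit_item) (auto simp: tokens_ok_def)
  moreover have "tokens_ok B ?\<sigma> ts N"
    using Cons.prems by (auto simp: tokens_ok_def)
  note Cons.IH[OF this]
  ultimately have "runs (emit B (i # ts)) \<sigma> (item_cost i * N + emit_cost ts * N)
      (?\<sigma>(B := rev (concat (map (text_of ?\<sigma>) ts)) @ ?\<sigma> B))"
    unfolding emit.simps by (rule runs_Seq)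
  moreover have "?\<sigma>(B := rev (concat (map (text_of ?\<sigma>) ts)) @ ?\<sigma> B) =
      \<sigma>(B := rev (concat (map (text_of \<sigma>) (i # ts))) @ \<sigma> B)"
    unfolding text_eq by auto
  moreover have "item_cost i * N + emit_cost ts * N = emit_cost (i # ts) * N"
    by (simp add: emit_cost_def algebra_simps)
  ultimately show ?case by (simp only:)
qed

section \<open>Loops over the input lists\<close>

text \<open>The vertices written so far are on stack \<open>2\<close> and the edges on stack \<open>3\<close>, last symbol on top.\<close>

lemma runs_foreach:
  assumes body: "\<And>e r \<sigma>. e \<in> set es \<Longrightarrow> \<forall>k\<ge>4. \<sigma> k = [] \<Longrightarrow> \<sigma> 0 = enc e @ r \<Longrightarrow>
      runs body \<sigma> (K * length (enc e)) (\<sigma>(0 := r, 2 := rev (f e) @ \<sigma> 2, 3 := rev (g e) @ \<sigma> 3))"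
    and enc: "\<And>e. e \<in> set es \<Longrightarrow> enc e \<noteq> [] \<and> hd (enc e) \<noteq> End"
    and \<sigma>: "\<forall>k\<ge>4. \<sigma> k = []" "\<sigma> 0 = concat (map enc es) @ End # r"
  shows "runs (WhileTop 0 (- {Some End}) body) \<sigma> (Suc K * length (concat (map enc es)) + 1)
    (\<sigma>(0 := End # r, 2 := rev (concat (map f es)) @ \<sigma> 2, 3 := rev (concat (map g es)) @ \<sigma> 3))"
  using assms
proof (induction es arbitrary: \<sigma>)
  case Nil
  then have "\<sigma>(0 := End # r) = \<sigma>" by auto
  with Nil runs_WhileFalse[of \<sigma> 0] show ?case by simp
next
  case (Cons e es)
  let ?r = "concat (map enc es) @ End # r"
  let ?\<sigma> = "\<sigma>(0 := ?r, 2 := rev (f e) @ \<sigma> 2, 3 := rev (g e) @ \<sigma> 3)"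
  have e: "enc e \<noteq> []" "hd (enc e) \<noteq> End" using Cons.prems(2) by auto
  have "runs body \<sigma> (K * length (enc e)) ?\<sigma>"
    by (rule Cons.prems(1)) (use Cons.prems(3,4) in auto)
  moreover have "runs (WhileTop 0 (- {Some End}) body) ?\<sigma>
      (Suc K * length (concat (map enc es)) + 1)
      (?\<sigma>(0 := End # r, 2 := rev (concat (map f es)) @ ?\<sigma> 2, 3 := rev (concat (map g es)) @ ?\<sigma> 3))"
    by (rule Cons.IH) (use Cons.prems in auto)
  moreover have "top_of (\<sigma> 0) \<in> - {Some End}"
    using e Cons.prems(4) by (cases "enc e") auto
  ultimately have "runs (WhileTop 0 (- {Some End}) body) \<sigma>
      (Suc (K * length (enc e) + (Suc K * length (concat (map enc es)) + 1)))
      (?\<sigma>(0 := End # r, 2 := rev (concat (map f es)) @ ?\<sigma> 2, 3 := rev (concat (map g es)) @ ?\<sigma> 3))"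
    by (intro runs_WhileTrue)
  moreover have "?\<sigma>(0 := End # r, 2 := rev (concat (map f es)) @ ?\<sigma> 2,
      3 := rev (concat (map g es)) @ ?\<sigma> 3) =
    \<sigma>(0 := End # r, 2 := rev (concat (map f (e # es))) @ \<sigma> 2,
      3 := rev (concat (map g (e # es))) @ \<sigma> 3)"
    by auto
  ultimately have "runs (WhileTop 0 (- {Some End}) body) \<sigma>
      (Suc (K * length (enc e) + (Suc K * length (concat (map enc es)) + 1)))
      (\<sigma>(0 := End # r, 2 := rev (concat (map f (e # es))) @ \<sigma> 2,
        3 := rev (concat (map g (e # es))) @ \<sigma> 3))"
    by (simp only:)
  \<comment> \<open>A nonempty encoding pays for the loop test of its round; this is the extra one
    in \<open>Suc K\<close>.\<close>
  moreover have "length (enc e) \<ge> 1" using e by (cases "enc e") auto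
  ultimately show ?case by (elim runs_mono) (simp add: algebra_simps)
qed

section \<open>Vertex names\<close>

fun bits :: "nat \<Rightarrow> bool list" where
  "bits n = (if n = 0 then [] else odd n # bits (n div 2))"

declare bits.simps [simp del]

fun num :: "bool list \<Rightarrow> nat" where
  "num [] = 0"
| "num (b # bs) = of_bool b + 2 * num bs"

definition digit :: "bool \<Rightarrow> 'a sym" where
  "digit b = (if b then One else Zero)"

lemma digits_eq: "digits n = map digit (bits n)"
proof (induction n rule: bits.induct)
  case (1 n)
  then show ?case
    by (subst digits.simps, subst bits.simps) (simp add: digit_def)
qed

lemma num_bits: "num (bits n) = n"
proof (induction n rule: bits.induct)
  case (1 n)
  then show ?case by (subst bits.simps) auto
qed

text \<open>A bit string is the expansion of a number once its last, most significant bit is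
  \<open>True\<close>; this is how a code word can be the digits of a vertex name.\<close>

lemma bits_num: "bits (num (bs @ [True])) = bs @ [True]"
proof (induction bs)
  case Nil
  show ?case by (simp add: bits.simps[of "Suc 0"] bits.simps[of 0])
next
  case (Cons b bs)
  have "num (bs @ [True]) > 0" by (induction bs) auto
  then show ?case using Cons by (subst bits.simps) auto
qed

section \<open>A self-delimiting code for vertices\<close>

definition spread :: "nat \<Rightarrow> bool list" where
  "spread n = concat (map (\<lambda>b. [True, b]) (bits n))"

text \<open>The codes are compared block by block: a leading \<open>True\<close> announces another
  digit, a leading \<open>False\<close> the end.\<close>

lemma spread_prefix_free:
  assumes "spread u @ False # r = spread v @ False # r'"
  shows "u = v \<and> r = r'"
proof -
  have "bs = bs' \<and> r = r'"
    if "concat (map (\<lambda>b. [True, b]) bs) @ False # r = concat (map (\<lambda>b. [True, b]) bs') @ False # r'"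
    for bs bs'
    using that
  proof (induction bs arbitrary: bs')
    case Nil
    then show ?case by (cases bs') auto
  next
    case (Cons b bs)
    then show ?case by (cases bs') auto
  qed
  from this[of "bits u" "bits v"] assms show ?thesis
    by (metis num_bits spread_def)
qed

lemma spread_inject: "spread u = spread v \<Longrightarrow> u = v"
  using spread_prefix_free[of u "[]" v "[]"] by simp

lemma replicate_prefix_free:
  "replicate i True @ False # r = replicate j True @ False # r' \<Longrightarrow> i = j \<and> r = r'"
proof (induction i arbitrary: j)
  case 0
  then show ?case by (cases j) auto
next
  case (Suc i)
  then show ?case by (cases j) auto
qed

text \<open>The final \<open>True\<close> makes the code a binary numeral without superfluous zeros.\<close>

definition key :: "nat \<Rightarrow> nat \<Rightarrow> nat \<Rightarrow> bool list" where
  "key i u v = replicate i True @ False # spread u @ False # spread v @ False # [True]"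

lemma key_inject: "key i u v = key j u' v' \<longleftrightarrow> i = j \<and> u = u' \<and> v = v'"
  unfolding key_def by (auto dest!: replicate_prefix_free spread_prefix_free dest: spread_inject)

datatype node = Orig nat | Mid nat nat nat | Pre nat | Suf nat

text \<open>Positions are tripled so that the residue modulo 3 tells the kind of node.
  \<open>Suf\<close> takes the positive multiples of three, as \<open>0\<close> belongs to
  \<open>Orig\<close>, which repeats \<open>u\<close> to fit the shape of
  \<open>key\<close>.\<close>

fun node_key :: "node \<Rightarrow> bool list" where
  "node_key (Orig u) = key 0 u u"
| "node_key (Mid i u v) = key (3 * i + 1) u v"
| "node_key (Pre i) = key (3 * i + 2) 0 0"
| "node_key (Suf i) = key (3 * i + 3) 0 0"

definition name :: "node \<Rightarrow> nat" where
  "name \<nu> = num (node_key \<nu>)"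

lemma bits_name: "bits (name \<nu>) = node_key \<nu>"
proof -
  obtain bs where "node_key \<nu> = bs @ [True]"
    by (cases \<nu>) (auto simp: key_def)
  then show ?thesis by (simp add: name_def bits_num)
qed

lemma inj_name: "inj name"
proof (rule injI)
  fix \<mu> \<nu> assume "name \<mu> = name \<nu>"
  then have eq: "node_key \<mu> = node_key \<nu>" by (metis bits_name)
  from eq show "\<mu> = \<nu>"
    by (cases \<mu>; cases \<nu>; simp add: key_inject; presburger)
qed

lemma enc_nat_name: "enc_nat (name \<nu>) = map digit (node_key \<nu>) @ [Sep]"
  by (simp add: enc_nat_def digits_eq bits_name)

section \<open>The graph built from \<open>H\<close>\<close>

datatype arc = YArc nat nat nat | XArc nat | ZArc nat

locale gadget =
  fixes x y z :: "'a list" and H :: "(nat, unit) lgraph" and \<pi> :: "nat \<times> nat \<Rightarrow> rat" and s t :: nat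
  assumes x: "x \<noteq> []" and y: "y \<noteq> []" and z: "z \<noteq> []"
    and H: "prob_graph H \<pi>"
    and s: "s \<in> verts H" and t: "t \<in> verts H"
begin

text \<open>Paths of adjacent edges meet because their ends are original vertices; for
  \<open>length y = 1\<close> there is no inner node.\<close>

definition ynode :: "nat \<Rightarrow> nat \<Rightarrow> nat \<Rightarrow> node" where
  "ynode u v i = (if i = 0 then Orig u else if i = length y then Orig v else Mid i u v)"

definition xnode :: "nat \<Rightarrow> node" where
  "xnode i = (if i = length x then Orig s else Pre i)"

definition znode :: "nat \<Rightarrow> node" where
  "znode i = (if i = 0 then Orig t else Suf i)"

fun src :: "arc \<Rightarrow> node" where
  "src (YArc u v i) = ynode u v i" | "src (XArc i) = xnode i" | "src (ZArc i) = znode i"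

fun tgt :: "arc \<Rightarrow> node" where
  "tgt (YArc u v i) = ynode u v (Suc i)"
| "tgt (XArc i) = xnode (Suc i)"
| "tgt (ZArc i) = znode (Suc i)"

fun alab :: "arc \<Rightarrow> 'a" where
  "alab (YArc u v i) = y ! i" | "alab (XArc i) = x ! i" | "alab (ZArc i) = z ! i"

text \<open>The probability sits on the last arc because the input gives it after both ends of the
  edge, so it can be copied as the final piece of the path's encoding.\<close>

fun aprob :: "arc \<Rightarrow> rat" where
  "aprob (YArc u v i) = (if Suc i = length y then \<pi> (u, v) else 1)"
| "aprob (XArc i) = 1"
| "aprob (ZArc i) = 1"

definition arcs :: "arc set" where
  "arcs = {YArc u v i | u v i. (u, v) \<in> edges H \<and> i < length y} \<union>
     XArc ` {..<length x} \<union> ZArc ` {..<length z}"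

definition nodes :: "node set" where
  "nodes = Orig ` verts H \<union> {Mid i u v | u v i. (u, v) \<in> edges H \<and> 0 < i \<and> i < length y} \<union>
     Pre ` {..<length x} \<union> Suf ` {1..length z}"

definition ends :: "arc \<Rightarrow> nat \<times> nat" where
  "ends a = (name (src a), name (tgt a))"

text \<open>Labels and probabilities are functions of pairs of names, hence the inverse of
  \<open>ends\<close>, which is injective on \<open>arcs\<close>.\<close>

definition graph :: "(nat, 'a) lgraph" where
  "graph = \<lparr>verts = name ` nodes, edges = ends ` arcs, lab = alab \<circ> inv_into arcs ends\<rparr>"

definition prb :: "nat \<times> nat \<Rightarrow> rat" where
  "prb = aprob \<circ> inv_into arcs ends"

section \<open>Well-formedness of the graph\<close>

lemma wf: "finite (verts H)" "edges H \<subseteq> verts H \<times> verts H" "finite (edges H)"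
proof -
  show "finite (verts H)" "edges H \<subseteq> verts H \<times> verts H"
    using H by (auto simp: prob_graph_def wf_graph_def)
  then show "finite (edges H)" by (meson finite_SigmaI finite_subset)
qed

lemma nodes_simps [simp]:
  "Orig u \<in> nodes \<longleftrightarrow> u \<in> verts H"
  "Mid i u v \<in> nodes \<longleftrightarrow> (u, v) \<in> edges H \<and> 0 < i \<and> i < length y"
  "Pre i \<in> nodes \<longleftrightarrow> i < length x"
  "Suf i \<in> nodes \<longleftrightarrow> 0 < i \<and> i \<le> length z"
  by (auto simp: nodes_def)

lemma finite_arcs: "finite arcs"
proof -
  have "{YArc u v i | u v i. (u, v) \<in> edges H \<and> i < length y} =
      (\<lambda>((u, v), i). YArc u v i) ` (edges H \<times> {..<length y})"
    by force
  then show ?thesis using wf by (simp add: arcs_def)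
qed

lemma finite_nodes: "finite nodes"
proof -
  have "{Mid i u v | u v i. (u, v) \<in> edges H \<and> 0 < i \<and> i < length y} \<subseteq>
      (\<lambda>((u, v), i). Mid i u v) ` (edges H \<times> {..<length y})"
    by force
  from finite_subset[OF this] show ?thesis using wf by (simp add: nodes_def)
qed

text \<open>An \<open>XArc\<close> starts in a \<open>Pre\<close> node and a \<open>ZArc\<close>
  ends in a \<open>Suf\<close> node. A \<open>YArc\<close> has a \<open>Mid\<close> end, which names
  its edge, unless \<open>length y = 1\<close>, when it joins \<open>Orig u\<close> and
  \<open>Orig v\<close> themselves.\<close>

lemma inj_ends: "inj_on ends arcs"
proof (rule inj_onI)
  fix a b assume "a \<in> arcs" "b \<in> arcs" "ends a = ends b"
  moreover from this inj_name have "src a = src b" "tgt a = tgt b"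
    by (auto simp: ends_def dest: injD)
  ultimately show "a = b"
    by (auto simp: arcs_def ynode_def xnode_def znode_def split: if_splits)
qed

lemma lab_ends: "a \<in> arcs \<Longrightarrow> lab graph (ends a) = alab a"
  by (simp add: graph_def inj_ends)

lemma prb_ends: "a \<in> arcs \<Longrightarrow> prb (ends a) = aprob a"
  by (simp add: prb_def inj_ends)

lemma ends_nodes: "a \<in> arcs \<Longrightarrow> src a \<in> nodes \<and> tgt a \<in> nodes"
  using wf(2) s t by (auto simp: arcs_def ynode_def xnode_def znode_def)

lemma prob_graph_graph: "prob_graph graph prb"
proof -
  have "0 \<le> aprob a \<and> aprob a \<le> 1" if "a \<in> arcs" for a
    using that H by (auto simp: arcs_def prob_graph_def)
  moreover have "nodes \<noteq> {}" using s by (auto simp: nodes_def)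
  ultimately show ?thesis
    using finite_nodes ends_nodes prb_ends
    by (auto simp: prob_graph_def wf_graph_def graph_def ends_def[of "_ :: arc"])
qed

section \<open>Soundness: what a walk reads and reaches\<close>

text \<open>The words read on the way from \<open>Pre 0\<close> to a node, as if every vertex of \<open>H\<close> could be reached
  from \<open>s\<close>, and \<open>t\<close> from every vertex, in any number of steps.\<close>

fun access :: "node \<Rightarrow> 'a list set" where
  "access (Orig u) = {x @ concat (replicate n y) | n. True}"
| "access (Mid i u v) = {x @ concat (replicate n y) @ take i y | n. True}"
| "access (Pre i) = {take i x}"
| "access (Suf i) = {x @ concat (replicate n y) @ take i z | n. True}"

lemma concat_replicate_snoc: "concat (replicate n w) @ w = concat (replicate (Suc n) w)"
  by (induction n) auto

lemma access_step:
  assumes a: "a \<in> arcs" and \<alpha>: "\<alpha> \<in> access (src a)"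
  shows "\<alpha> @ [alab a] \<in> access (tgt a)"
proof -
  consider (Y) u v i where "a = YArc u v i" "i < length y"
    | (X) i where "a = XArc i" "i < length x" | (Z) i where "a = ZArc i" "i < length z"
    using a by (auto simp: arcs_def)
  then show ?thesis
  proof cases
    case Y
    with \<alpha> obtain n where "\<alpha> = x @ concat (replicate n y) @ take i y"
      by (auto simp: ynode_def split: if_splits)
    then have *: "\<alpha> @ [alab a] = x @ concat (replicate n y) @ take (Suc i) y"
      using Y by (simp add: take_Suc_conv_app_nth)
    show ?thesis
    proof (cases "Suc i = length y")
      \<comment> \<open>The path is complete: the arc enters \<open>Orig v\<close> and finishes one
        more copy of \<open>y\<close>.\<close>
      case True
      then have "\<alpha> @ [alab a] = x @ concat (replicate (Suc n) y)"
        using * concat_replicate_snoc[of n y] by simp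
      then show ?thesis using Y True by (auto simp: ynode_def intro!: exI[of _ "Suc n"])
    next
      case False
      then show ?thesis unfolding * using Y by (auto simp: ynode_def)
    qed
  next
    case X
    with \<alpha> have *: "\<alpha> @ [alab a] = take (Suc i) x"
      by (auto simp: xnode_def take_Suc_conv_app_nth)
    \<comment> \<open>On arrival at \<open>Orig s\<close> the word is \<open>x\<close> with no copy
      of \<open>y\<close>, hence the witness \<open>0\<close>.\<close>
    show ?thesis
      unfolding * using X by (auto simp: xnode_def intro: exI[of _ 0])
  next
    case Z
    with \<alpha> obtain n where "\<alpha> = x @ concat (replicate n y) @ take i z"
      by (auto simp: znode_def split: if_splits)
    then have "\<alpha> @ [alab a] = x @ concat (replicate n y) @ take (Suc i) z"
      using Z by (simp add: take_Suc_conv_app_nth)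
    then show ?thesis using Z by (auto simp: znode_def)
  qed
qed

text \<open>The arcs that remain when exactly the edges in \<open>E\<close> are kept: only the last
  arc of a path for an edge can be missing.\<close>

definition live :: "(nat \<times> nat) set \<Rightarrow> arc set" where
  "live E = {a \<in> arcs. \<forall>u v i. a = YArc u v i \<longrightarrow> Suc i = length y \<longrightarrow> (u, v) \<in> E}"

text \<open>An invariant of walks that is trivial at the start and yields the claim at a
  \<open>Suf\<close> node. At \<open>Mid i u v\<close> it speaks of \<open>u\<close> only, because
  the arc into \<open>v\<close> may be missing.\<close>

fun reachable :: "(nat \<times> nat) set \<Rightarrow> node \<Rightarrow> bool" where
  "reachable E (Orig u) \<longleftrightarrow> (s, u) \<in> E\<^sup>*"
| "reachable E (Mid i u v) \<longleftrightarrow> (s, u) \<in> E\<^sup>*"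
| "reachable E (Pre i) \<longleftrightarrow> True"
| "reachable E (Suf i) \<longleftrightarrow> (s, t) \<in> E\<^sup>*"

lemma reachable_step: "a \<in> live E \<Longrightarrow> reachable E (src a) \<Longrightarrow> reachable E (tgt a)"
  by (auto simp: live_def arcs_def ynode_def xnode_def znode_def split: if_splits
      intro: rtrancl_into_rtrancl)

abbreviation sub :: "(nat \<times> nat) set \<Rightarrow> (nat, 'a) lgraph" where
  "sub E \<equiv> graph\<lparr>edges := ends ` live E\<rparr>"

lemma live_arcs: "a \<in> live E \<Longrightarrow> a \<in> arcs"
  by (simp add: live_def)

text \<open>Carries both invariants along a walk. The walk may start anywhere, so
  \<open>\<alpha>\<close> stands for whatever could have been read before it.\<close>

lemma lwalk_sub:
  assumes "lwalk (sub E) (name \<mu>) w v"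
  obtains \<nu> where "v = name \<nu>" "\<nu> \<in> nodes \<or> \<nu> = \<mu>"
    "\<And>\<alpha>. \<alpha> \<in> access \<mu> \<Longrightarrow> \<alpha> @ w \<in> access \<nu>"
    "reachable E \<mu> \<Longrightarrow> reachable E \<nu>"
  using assms
proof (induction w arbitrary: \<mu> thesis)
  case Nil
  then show ?case by auto
next
  case (Cons b w)
  from Cons.prems(2) obtain u' where u': "(name \<mu>, u') \<in> ends ` live E"
    "lab graph (name \<mu>, u') = b" "lwalk (sub E) u' w v"
    by auto
  then obtain a where a: "a \<in> live E" "name \<mu> = name (src a)" "u' = name (tgt a)"
    by (auto simp: ends_def)
  with u' have b: "b = alab a"
    using lab_ends[OF live_arcs, of a E] by (simp add: ends_def)
  have \<mu>: "\<mu> = src a" using a inj_name by (auto dest: injD)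
  obtain \<nu> where \<nu>: "v = name \<nu>" "\<nu> \<in> nodes \<or> \<nu> = tgt a"
    "\<And>\<alpha>. \<alpha> \<in> access (tgt a) \<Longrightarrow> \<alpha> @ w \<in> access \<nu>"
    "reachable E (tgt a) \<Longrightarrow> reachable E \<nu>"
    using Cons.IH u'(3) a(3) by metis
  show ?case
  proof (rule Cons.prems(1)[OF \<nu>(1)])
    show "\<nu> \<in> nodes \<or> \<nu> = \<mu>" using \<nu>(2) ends_nodes live_arcs a by auto
    show "\<alpha> @ b # w \<in> access \<nu>" if "\<alpha> \<in> access \<mu>" for \<alpha>
      using \<nu>(3)[OF access_step[of a \<alpha>]] that b \<mu> live_arcs[OF a(1)] by simp
    show "reachable E \<nu>" if "reachable E \<mu>"
      using \<nu>(4) reachable_step[OF a(1)] that \<mu> by blast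
  qed
qed

lemma access_nonempty: "\<exists>\<alpha>. \<alpha> \<in> access \<mu>"
  by (cases \<mu>) auto

lemma access_not_Nil: "\<alpha> \<in> access \<mu> \<Longrightarrow> \<mu> \<noteq> Pre 0 \<Longrightarrow> \<alpha> \<noteq> []"
  using x by (cases \<mu>) auto

text \<open>Finish the current path and go on to the end of the path for \<open>z\<close>, as if
  \<open>t\<close> were always at hand. Since \<open>z\<close> is nonempty, something remains to be
  read except at the very last node.\<close>

lemma access_extend:
  assumes "\<alpha> \<in> access \<mu>" "\<mu> \<in> nodes"
  shows "\<exists>\<beta> n. \<alpha> @ \<beta> = x @ concat (replicate n y) @ z \<and> (\<beta> = [] \<longrightarrow> \<mu> = Suf (length z))"
proof (cases \<mu>)
  case (Orig u)
  with assms obtain n where "\<alpha> = x @ concat (replicate n y)" by auto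
  with z show ?thesis by (intro exI[of _ z] exI[of _ n]) simp
next
  case (Mid i u v)
  with assms obtain n where "\<alpha> = x @ concat (replicate n y) @ take i y" by auto
  moreover have "take i y @ drop i y = y" by simp
  ultimately have "\<alpha> @ drop i y @ z = x @ concat (replicate (Suc n) y) @ z"
    using concat_replicate_snoc[of n y] by (metis append.assoc)
  with z show ?thesis by (intro exI[of _ "drop i y @ z"] exI[of _ "Suc n"]) simp
next
  case (Pre i)
  with assms have "\<alpha> @ drop i x @ z = x @ concat (replicate 0 y) @ z"
    by (simp add: append.assoc[symmetric] del: append.assoc)
  with z show ?thesis by (intro exI[of _ "drop i x @ z"] exI[of _ 0]) simp
next
  case (Suf i)
  with assms obtain n where "\<alpha> = x @ concat (replicate n y) @ take i z" "i \<le> length z"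
    by (auto simp: nodes_def)
  with Suf show ?thesis by (intro exI[of _ "drop i z"] exI[of _ n]) simp
qed

lemma sub_RPQ_sound:
  assumes L: "\<And>n. x @ concat (replicate n y) @ z \<in> infix_free L" and RPQ: "RPQ L (sub E)"
  shows "(s, t) \<in> E\<^sup>*"
proof -
  from RPQ obtain w u v where w: "w \<in> L" "lwalk (sub E) u w v"
    by (auto simp: RPQ_iff_lwalk)
  have "u \<in> verts graph" using w(2) by (cases w) auto
  then obtain \<mu> where \<mu>: "u = name \<mu>" "\<mu> \<in> nodes" by (auto simp: graph_def)
  from w(2) obtain \<nu> where \<nu>: "\<nu> \<in> nodes"
    "\<And>\<alpha>. \<alpha> \<in> access \<mu> \<Longrightarrow> \<alpha> @ w \<in> access \<nu>"
    "reachable E \<mu> \<Longrightarrow> reachable E \<nu>"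
    unfolding \<mu>(1) by (rule lwalk_sub) (use \<mu>(2) in auto)
  obtain \<alpha> where \<alpha>: "\<alpha> \<in> access \<mu>" using access_nonempty by blast
  obtain \<beta> n where \<beta>: "\<alpha> @ w @ \<beta> = x @ concat (replicate n y) @ z"
    and \<beta>_Nil: "\<beta> = [] \<longrightarrow> \<nu> = Suf (length z)"
    using access_extend[OF \<nu>(2)[OF \<alpha>] \<nu>(1)] by auto
  \<comment> \<open>The completed word is infix-free in \<open>L\<close>, so its infix
    \<open>w\<close>, which is in \<open>L\<close>, must be all of it.\<close>
  have "\<not> strict_sublist w (\<alpha> @ w @ \<beta>)"
    unfolding \<beta> using L[of n] w(1) by (auto simp: infix_free_def)
  then have "w = \<alpha> @ w @ \<beta>" by (auto simp: strict_sublist_def)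
  from arg_cong[OF this, of length] have "\<alpha> = []" "\<beta> = []" by simp_all
  \<comment> \<open>The walk leads from the first node, where \<open>reachable\<close> holds
    trivially, to the last, where it says that \<open>t\<close> is reachable from
    \<open>s\<close>.\<close>
  then have "\<mu> = Pre 0" "\<nu> = Suf (length z)" using \<beta>_Nil access_not_Nil[OF \<alpha>] by auto
  with \<nu>(3) show ?thesis by simp
qed

section \<open>Completeness: walks along the paths for \<open>x\<close>, \<open>y\<close> and
  \<open>z\<close>\<close>

lemma lwalk_arcs:
  assumes "\<And>i. i < length w \<Longrightarrow> a i \<in> live E \<and> src (a i) = \<nu> i \<and> tgt (a i) = \<nu> (Suc i) \<and> alab (a i) = w ! i"
    and "\<nu> (length w) \<in> nodes"
  shows "lwalk (sub E) (name (\<nu> 0)) w (name (\<nu> (length w)))"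
  using assms
proof (induction w arbitrary: a \<nu>)
  case Nil
  then show ?case by (simp add: graph_def)
next
  case (Cons b w)
  have "lwalk (sub E) (name (\<nu> (Suc 0))) w (name (\<nu> (Suc (length w))))"
    using Cons.prems Cons.IH[of "a \<circ> Suc" "\<nu> \<circ> Suc"] by fastforce
  moreover have a: "a 0 \<in> live E" "src (a 0) = \<nu> 0" "tgt (a 0) = \<nu> (Suc 0)" "alab (a 0) = b"
    using Cons.prems(1)[of 0] by auto
  moreover have "(name (\<nu> 0), name (\<nu> (Suc 0))) = ends (a 0)" using a by (simp add: ends_def)
  moreover have "name (\<nu> 0) \<in> verts graph"
    using a ends_nodes live_arcs by (fastforce simp: graph_def)
  ultimately show ?case using lab_ends[OF live_arcs[OF a(1)]] by auto
qed

lemma sub_RPQ_complete: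
  assumes L: "\<And>n. x @ concat (replicate n y) @ z \<in> L" and E: "E \<subseteq> edges H"
    and st: "(s, t) \<in> E\<^sup>*"
  shows "RPQ L (sub E)"
proof -
  have X: "lwalk (sub E) (name (Pre 0)) x (name (Orig s))"
  proof -
    have "lwalk (sub E) (name (xnode 0)) x (name (xnode (length x)))"
      by (rule lwalk_arcs[where a = XArc]) (use s in \<open>auto simp: live_def arcs_def xnode_def\<close>)
    then show ?thesis using x by (simp add: xnode_def)
  qed
  have Z: "lwalk (sub E) (name (Orig t)) z (name (Suf (length z)))"
  proof -
    have "lwalk (sub E) (name (znode 0)) z (name (znode (length z)))"
      by (rule lwalk_arcs[where a = ZArc]) (use z in \<open>auto simp: live_def arcs_def znode_def Suc_le_eq\<close>)
    then show ?thesis using z by (simp add: znode_def)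
  qed
  \<comment> \<open>For an edge in \<open>E\<close> every arc of its path is live, the last one
    included.\<close>
  have Y: "lwalk (sub E) (name (Orig u)) y (name (Orig v))" if uv: "(u, v) \<in> E" for u v
  proof -
    have "(u, v) \<in> edges H" "v \<in> verts H" using uv E wf(2) by auto
    then have "lwalk (sub E) (name (ynode u v 0)) y (name (ynode u v (length y)))"
      using uv y by (intro lwalk_arcs[where a = "YArc u v"]) (simp_all add: live_def arcs_def ynode_def)
    then show ?thesis using y by (simp add: ynode_def)
  qed
  have "\<exists>n. lwalk (sub E) (name (Pre 0)) (x @ concat (replicate n y)) (name (Orig v))"
    if "(s, v) \<in> E\<^sup>*" for v
    using that
  proof induction
    case base
    show ?case using X by (intro exI[of _ 0]) simp
  next
    case (step u v)
    then obtain n where "lwalk (sub E) (name (Pre 0)) (x @ concat (replicate n y)) (name (Orig u))"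
      by blast
    from lwalk_append[OF this Y[OF step(2)]] show ?case
      using concat_replicate_snoc[of n y] by (intro exI[of _ "Suc n"]) simp
  qed
  from this[OF st]
  obtain n where "lwalk (sub E) (name (Pre 0)) (x @ concat (replicate n y)) (name (Orig t))"
    by blast
  from lwalk_append[OF this Z] L[of n] show ?thesis by (auto simp: RPQ_iff_lwalk)
qed

theorem PQE_graph:
  assumes L: "\<And>n. x @ concat (replicate n y) @ z \<in> infix_free L"
  shows "PQE (RPQ L) graph prb = stcon H \<pi> s t"
proof -
  \<comment> \<open>\<open>fin e\<close> is the last arc of the path for \<open>e\<close>, which
    exists as \<open>y\<close> is nonempty. It is the arc that stands for \<open>e\<close>; all
    other arcs form \<open>C\<close> and are certain.\<close>
  define fin where "fin = (\<lambda>(u, v). YArc u v (length y - 1))"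
  define \<iota> where \<iota>: "\<iota> = ends \<circ> fin"
  have fin: "fin ` edges H \<subseteq> arcs" using y by (auto simp: fin_def arcs_def)
  have inj_fin: "inj_on fin A" for A by (auto simp: fin_def inj_on_def)
  define C where "C = arcs - fin ` edges H"
  have live: "ends ` C \<union> \<iota> ` E = ends ` live E" if "E \<subseteq> edges H" for E
  proof -
    have "live E = C \<union> fin ` E"
      using that fin by (auto simp: live_def C_def fin_def arcs_def image_iff split: prod.splits)
    then show ?thesis by (simp add: \<iota> image_Un image_comp)
  qed
  show ?thesis
    unfolding PQE_def stcon_def
  proof (rule total_prob_embed[where C = "ends ` C" and \<iota> = \<iota>])
    show "finite (edges H)" by (rule wf)
    show "finite (ends ` C)" using finite_arcs by (simp add: C_def)
    show "edges graph = ends ` C \<union> \<iota> ` edges H"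
      using fin by (auto simp: graph_def C_def \<iota>)
    show "ends ` C \<inter> \<iota> ` edges H = {}"
    proof -
      have "ends ` C \<inter> ends ` fin ` edges H = ends ` (C \<inter> fin ` edges H)"
        using fin inj_on_image_Int[OF inj_ends, of C "fin ` edges H"] by (simp add: C_def)
      also have "C \<inter> fin ` edges H = {}" by (auto simp: C_def)
      finally show ?thesis by (simp add: \<iota> image_comp)
    qed
    show "inj_on \<iota> (edges H)"
      unfolding \<iota> using inj_ends fin by (intro comp_inj_on inj_fin) (auto intro: inj_on_subset)
    show "prb e = 1" if "e \<in> ends ` C" for e
      using that by (auto simp: C_def prb_ends arcs_def fin_def image_iff split: prod.splits)
    show "prb (\<iota> e) = \<pi> e" if "e \<in> edges H" for e
    proof -
      have "fin e \<in> arcs" using fin that by blast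
      then show ?thesis using y by (cases e) (simp add: \<iota> prb_ends fin_def)
    qed
    show "RPQ L (graph\<lparr>edges := ends ` C \<union> \<iota> ` E\<rparr>) \<longleftrightarrow> has_dipath s t (H\<lparr>edges := E\<rparr>)"
      if E: "E \<subseteq> edges H" for E
    proof -
      have "has_dipath s t (H\<lparr>edges := E\<rparr>) \<longleftrightarrow> (s, t) \<in> E\<^sup>*"
        using has_dipath_iff_rtrancl[of s "H\<lparr>edges := E\<rparr>" t] E s wf(2) by auto
      moreover have "RPQ L (sub E) \<longleftrightarrow> (s, t) \<in> E\<^sup>*"
        using sub_RPQ_sound[OF L] sub_RPQ_complete[OF _ E] L by (auto simp: infix_free_def)
      ultimately show ?thesis by (simp add: live[OF E])
    qed
  qed
qed

end

section \<open>The program\<close>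

definition rendered :: "'a sym store \<Rightarrow> 'a item list \<Rightarrow> 'a sym list" where
  "rendered \<sigma> ts = concat (map (text_of \<sigma>) ts)"

lemma rendered_simps [simp]:
  "rendered \<sigma> [] = []"
  "rendered \<sigma> (i # ts) = text_of \<sigma> i @ rendered \<sigma> ts"
  "rendered \<sigma> (ts @ us) = rendered \<sigma> ts @ rendered \<sigma> us"
  by (simp_all add: rendered_def)

lemma rendered_concat: "rendered \<sigma> (concat (map F js)) = concat (map (\<lambda>j. rendered \<sigma> (F j)) js)"
  by (induction js) auto

definition holds :: "'a sym store \<Rightarrow> nat \<Rightarrow> nat \<Rightarrow> bool" where
  "holds \<sigma> A n \<longleftrightarrow> \<sigma> A = rev (digits n)"

text \<open>Mirrors \<open>key\<close>: the last constant holds the final \<open>False\<close> and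
  \<open>True\<close> of the code and the separator of \<open>enc_nat\<close>.\<close>

definition key_items :: "nat \<Rightarrow> nat \<Rightarrow> nat \<Rightarrow> 'a item list" where
  "key_items i A B =
     [Const (replicate i One @ [Zero]), Token A, Const [Zero], Token B, Const [Zero, One, Sep]]"

lemma rendered_key_items:
  fixes \<sigma> :: "'a sym store"
  assumes "holds \<sigma> A u" "holds \<sigma> B v"
  shows "rendered \<sigma> (key_items i A B) = map digit (key i u v) @ [Sep]"
proof -
  have "concat (map (\<lambda>c. [One, c]) (digits n :: 'a sym list)) = map digit (spread n)" for n
    by (simp add: digits_eq spread_def map_concat o_def digit_def)
  then show ?thesis
    using assms by (simp add: key_items_def key_def holds_def digit_def)
qed

lemma Token_key_items: "Token C \<in> set (key_items i A B) \<longleftrightarrow> C = A \<or> C = B"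
  by (auto simp: key_items_def)

text \<open>Stacks \<open>4\<close> and \<open>5\<close> hold the two ends of an edge of \<open>H\<close> or the pair \<open>s\<close>, \<open>t\<close>; stack \<open>7\<close> is
  always empty, that is, it holds \<open>0\<close>.\<close>

definition ynode_items :: "nat \<Rightarrow> nat \<Rightarrow> 'a item list" where
  "ynode_items k i =
     (if i = 0 then key_items 0 4 4 else if i = k then key_items 0 5 5 else key_items (3 * i + 1) 4 5)"

definition xnode_items :: "nat \<Rightarrow> nat \<Rightarrow> 'a item list" where
  "xnode_items k i = (if i = k then key_items 0 4 4 else key_items (3 * i + 2) 7 7)"

definition znode_items :: "nat \<Rightarrow> 'a item list" where
  "znode_items i = (if i = 0 then key_items 0 5 5 else key_items (3 * i + 3) 7 7)"

definition mid_items :: "nat \<Rightarrow> 'a item list" where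
  "mid_items k = concat (map (\<lambda>i. key_items (3 * i + 1) 4 5) [1..<k])"

text \<open>The last arc is left without its probability, which \<open>edge_body\<close> then copies
  from the input.\<close>

definition yarc_items :: "'a list \<Rightarrow> 'a item list" where
  "yarc_items y = concat (map (\<lambda>i. ynode_items (length y) i @ ynode_items (length y) (Suc i) @
     [Const (Letter (y ! i) # (if Suc i = length y then [] else enc_prob 1))]) [0..<length y])"

definition end_node_items :: "nat \<Rightarrow> nat \<Rightarrow> 'a item list" where
  "end_node_items k l = concat (map (\<lambda>i. key_items (3 * i + 2) 7 7) [0..<k]) @
     concat (map (\<lambda>i. key_items (3 * i + 3) 7 7) [1..<Suc l])"

definition end_arc_items :: "'a list \<Rightarrow> 'a list \<Rightarrow> 'a item list" where
  "end_arc_items x z =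
     concat (map (\<lambda>i. xnode_items (length x) i @ xnode_items (length x) (Suc i) @
       [Const (Letter (x ! i) # enc_prob 1)]) [0..<length x]) @
     concat (map (\<lambda>i. znode_items i @ znode_items (Suc i) @
       [Const (Letter (z ! i) # enc_prob 1)]) [0..<length z])"

definition vertex_body :: "'a sym prog" where
  "vertex_body = Seq (read_token 4) (Seq (emit 2 (key_items 0 4 4)) (clear_token 4))"

definition edge_body :: "'a list \<Rightarrow> 'a sym prog" where
  "edge_body y = Seq (read_token 4) (Seq (read_token 5)
     (Seq (emit 2 (mid_items (length y))) (Seq (emit 3 (yarc_items y))
     (Seq (copy_token 3) (Seq (copy_token 3) (Seq (clear_token 4) (clear_token 5)))))))"

definition all_syms :: "'a::finite sym list" where
  "all_syms = (SOME cs. set cs = UNIV)"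

lemma set_all_syms [simp]: "set all_syms = UNIV"
  unfolding all_syms_def by (rule someI_ex) (simp add: finite_list)

text \<open>The output is read from the top, so it is built from its end: edges before vertices. The
  transfers undo the reversed order on stacks \<open>2\<close> and \<open>3\<close>.\<close>

definition finish :: "'a::finite sym prog" where
  "finish = Seq (Push 1 End) (Seq (transfer 3 all_syms (\<lambda>c. [(1, c)]))
     (Seq (Push 1 End) (transfer 2 all_syms (\<lambda>c. [(1, c)]))))"

text \<open>The inner nodes of the paths for \<open>x\<close> and \<open>z\<close> do not depend on
  the input and come first; their arcs involve \<open>s\<close> and \<open>t\<close>, which the
  input gives last.\<close>

definition collect :: "'a list \<Rightarrow> 'a list \<Rightarrow> 'a list \<Rightarrow> 'a sym prog" where
  "collect x y z = Seq (emit 2 (end_node_items (length x) (length z)))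
     (Seq (WhileTop 0 (- {Some End}) vertex_body) (Seq (Pop 0)
     (Seq (WhileTop 0 (- {Some End}) (edge_body y)) (Seq (Pop 0)
     (Seq (read_token 4) (Seq (read_token 5) (emit 3 (end_arc_items x z))))))))"

definition reduction :: "'a::finite list \<Rightarrow> 'a list \<Rightarrow> 'a list \<Rightarrow> 'a sym prog" where
  "reduction x y z = Seq (collect x y z) finish"

section \<open>Results and costs of the program parts\<close>

lemma holds_bits: "holds \<sigma> A n \<Longrightarrow> set (\<sigma> A) \<subseteq> {Zero, One}"
  using set_digits[of n] by (simp add: holds_def)

lemma holds_length: "holds (\<sigma> :: 'a sym store) A n \<Longrightarrow> length (\<sigma> A) < length (enc_nat n :: 'a sym list)"
  by (simp add: holds_def enc_nat_def)

text \<open>\<open>12\<close> is seven steps per symbol for reading and five for clearing; the token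
  is shorter than its encoding, which absorbs the last step of clearing.\<close>

lemma runs_vertex_body:
  fixes \<sigma> :: "'a sym store"
  assumes \<sigma>: "\<forall>k\<ge>4. \<sigma> k = []" "\<sigma> 0 = enc_nat u @ r"
  shows "runs vertex_body \<sigma>
    ((12 + emit_cost (key_items 0 4 4 :: 'a item list)) * length (enc_nat u :: 'a sym list))
    (\<sigma>(0 := r, 2 := rev (enc_nat (name (Orig u))) @ \<sigma> 2, 3 := rev [] @ \<sigma> 3))"
proof -
  let ?c = "length (enc_nat u :: 'a sym list)"
  let ?ts = "key_items 0 4 4 :: 'a item list"
  let ?\<sigma>1 = "\<sigma>(0 := r, 4 := rev (digits u) @ \<sigma> 4)"
  let ?\<sigma>2 = "?\<sigma>1(2 := rev (rendered ?\<sigma>1 ?ts) @ ?\<sigma>1 2)"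
  have h: "holds ?\<sigma>1 4 u" using \<sigma> by (simp add: holds_def)
  have 1: "runs (read_token 4) \<sigma> (7 * ?c) ?\<sigma>1"
    using \<sigma>(2) by (rule runs_read_token) simp
  have "tokens_ok 2 ?\<sigma>1 ?ts ?c"
    using \<sigma>(1) holds_bits[OF h] holds_length[OF h]
    by (auto simp: tokens_ok_def Token_key_items enc_nat_def)
  from runs_emit[OF this] have 2: "runs (emit 2 ?ts) ?\<sigma>1 (emit_cost ?ts * ?c) ?\<sigma>2"
    by (simp only: rendered_def)
  have 3: "runs (clear_token 4) ?\<sigma>2 (5 * length (?\<sigma>2 4) + 1) (?\<sigma>2(4 := []))"
    using holds_bits[OF h] by (intro runs_clear_token) simp
  have "?\<sigma>2(4 := []) = \<sigma>(0 := r, 2 := rev (enc_nat (name (Orig u))) @ \<sigma> 2, 3 := rev [] @ \<sigma> 3)"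
    using \<sigma>(1) rendered_key_items[OF h h, of 0] by (auto simp: enc_nat_name)
  with runs_Seq[OF 1 runs_Seq[OF 2 3]] have "runs vertex_body \<sigma>
      (7 * ?c + (emit_cost ?ts * ?c + (5 * length (?\<sigma>2 4) + 1)))
      (\<sigma>(0 := r, 2 := rev (enc_nat (name (Orig u))) @ \<sigma> 2, 3 := rev [] @ \<sigma> 3))"
    by (simp only: vertex_body_def)
  then show ?thesis
    by (rule runs_mono) (use holds_length[OF h] in \<open>simp add: algebra_simps\<close>)
qed

lemma Token_mid_items: "Token A \<in> set (mid_items k) \<Longrightarrow> A = 4 \<or> A = 5"
  by (auto simp: mid_items_def Token_key_items)

lemma Token_yarc_items: "Token A \<in> set (yarc_items y) \<Longrightarrow> A = 4 \<or> A = 5"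
  by (auto simp: yarc_items_def ynode_items_def Token_key_items split: if_splits)

lemma Token_end_node_items: "Token A \<in> set (end_node_items k l) \<Longrightarrow> A = 7"
  by (auto simp: end_node_items_def Token_key_items)

lemma Token_end_arc_items: "Token A \<in> set (end_arc_items x z) \<Longrightarrow> A = 4 \<or> A = 5 \<or> A = 7"
  by (auto simp: end_arc_items_def xnode_items_def znode_items_def Token_key_items split: if_splits)

lemma rendered_mid_items:
  assumes "holds \<sigma> 4 u" "holds \<sigma> 5 v"
  shows "rendered \<sigma> (mid_items k) = concat (map (\<lambda>i. enc_nat (name (Mid i u v))) [1..<k])"
  unfolding mid_items_def rendered_concat
  by (simp add: rendered_key_items[OF assms] enc_nat_name)

lemma rendered_end_node_items:
  assumes "holds \<sigma> 7 0"
  shows "rendered \<sigma> (end_node_items k l) =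
    concat (map (\<lambda>i. enc_nat (name (Pre i))) [0..<k]) @
    concat (map (\<lambda>i. enc_nat (name (Suf i))) [1..<Suc l])"
  unfolding end_node_items_def rendered_simps rendered_concat
  by (simp add: rendered_key_items[OF assms assms] enc_nat_name del: upt_Suc)

text \<open>\<open>M\<close> and \<open>Y\<close> are required for every store holding
  \<open>u\<close> and \<open>v\<close>, because the two templates are rendered in different stores.
  The rate \<open>13\<close> covers reading and clearing the ends as well as copying
  \<open>p\<close> and \<open>q\<close>.\<close>

lemma runs_edge_body:
  fixes \<sigma> :: "'a sym store"
  assumes \<sigma>: "\<forall>k\<ge>4. \<sigma> k = []" "\<sigma> 0 = enc_nat u @ enc_nat v @ enc_nat p @ enc_nat q @ r"
    and mid: "\<And>\<tau>. holds \<tau> 4 u \<Longrightarrow> holds \<tau> 5 v \<Longrightarrow> rendered \<tau> (mid_items (length y)) = M"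
    and yarc: "\<And>\<tau>. holds \<tau> 4 u \<Longrightarrow> holds \<tau> 5 v \<Longrightarrow> rendered \<tau> (yarc_items y) = Y"
  shows "runs (edge_body y) \<sigma>
    ((13 + emit_cost (mid_items (length y) :: 'a item list) + emit_cost (yarc_items y)) *
      length (enc_nat u @ enc_nat v @ enc_nat p @ enc_nat q :: 'a sym list))
    (\<sigma>(0 := r, 2 := rev M @ \<sigma> 2, 3 := rev (Y @ enc_nat p @ enc_nat q) @ \<sigma> 3))"
proof -
  let ?l = "\<lambda>n. length (enc_nat n :: 'a sym list)"
  let ?c = "?l u + ?l v + ?l p + ?l q"
  let ?m = "mid_items (length y) :: 'a item list"
  let ?\<sigma>1 = "\<sigma>(0 := enc_nat v @ enc_nat p @ enc_nat q @ r, 4 := rev (digits u) @ \<sigma> 4)"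
  let ?\<sigma>2 = "?\<sigma>1(0 := enc_nat p @ enc_nat q @ r, 5 := rev (digits v) @ ?\<sigma>1 5)"
  let ?\<sigma>3 = "?\<sigma>2(2 := rev M @ ?\<sigma>2 2)"
  let ?\<sigma>4 = "?\<sigma>3(3 := rev Y @ ?\<sigma>3 3)"
  let ?\<sigma>5 = "?\<sigma>4(0 := enc_nat q @ r, 3 := rev (enc_nat p) @ ?\<sigma>4 3)"
  let ?\<sigma>6 = "?\<sigma>5(0 := r, 3 := rev (enc_nat q) @ ?\<sigma>5 3)"
  have h2: "holds ?\<sigma>2 4 u" "holds ?\<sigma>2 5 v" using \<sigma>(1) by (auto simp: holds_def)
  have h3: "holds ?\<sigma>3 4 u" "holds ?\<sigma>3 5 v" using \<sigma>(1) by (auto simp: holds_def)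
  have 1: "runs (read_token 4) \<sigma> (7 * ?l u) ?\<sigma>1"
    using \<sigma>(2) by (rule runs_read_token) simp
  have 2: "runs (read_token 5) ?\<sigma>1 (7 * ?l v) ?\<sigma>2"
    by (rule runs_read_token) simp_all
  have "tokens_ok 2 ?\<sigma>2 ?m ?c"
    using \<sigma>(1) holds_bits[OF h2(1)] holds_bits[OF h2(2)] holds_length[OF h2(1)] holds_length[OF h2(2)]
    by (auto simp: tokens_ok_def enc_nat_def dest!: Token_mid_items)
  from runs_emit[OF this] have 3: "runs (emit 2 ?m) ?\<sigma>2 (emit_cost ?m * ?c) ?\<sigma>3"
    unfolding rendered_def[symmetric] mid[OF h2] .
  have "tokens_ok 3 ?\<sigma>3 (yarc_items y) ?c"
    using \<sigma>(1) holds_bits[OF h3(1)] holds_bits[OF h3(2)] holds_length[OF h3(1)] holds_length[OF h3(2)]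
    by (auto simp: tokens_ok_def enc_nat_def dest!: Token_yarc_items)
  from runs_emit[OF this] have 4: "runs (emit 3 (yarc_items y)) ?\<sigma>3 (emit_cost (yarc_items y) * ?c) ?\<sigma>4"
    unfolding rendered_def[symmetric] yarc[OF h3] .
  have 5: "runs (copy_token 3) ?\<sigma>4 (8 * ?l p) ?\<sigma>5"
    by (rule runs_copy_token) simp_all
  have 6: "runs (copy_token 3) ?\<sigma>5 (8 * ?l q) ?\<sigma>6"
    by (rule runs_copy_token) simp_all
  have 7: "runs (clear_token 4) ?\<sigma>6 (5 * length (?\<sigma>6 4) + 1) (?\<sigma>6(4 := []))"
    using holds_bits[OF h2(1)] by (intro runs_clear_token) simp
  let ?\<sigma>7 = "?\<sigma>6(4 := [])"
  have 8: "runs (clear_token 5) ?\<sigma>7 (5 * length (?\<sigma>7 5) + 1) (?\<sigma>7(5 := []))"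
    using holds_bits[OF h2(2)] by (intro runs_clear_token) simp
  have "?\<sigma>7(5 := []) = \<sigma>(0 := r, 2 := rev M @ \<sigma> 2, 3 := rev (Y @ enc_nat p @ enc_nat q) @ \<sigma> 3)"
    using \<sigma>(1) by auto
  with runs_Seq[OF 1 runs_Seq[OF 2 runs_Seq[OF 3 runs_Seq[OF 4 runs_Seq[OF 5
    runs_Seq[OF 6 runs_Seq[OF 7 8]]]]]]]
  have "runs (edge_body y) \<sigma> (7 * ?l u + (7 * ?l v + (emit_cost ?m * ?c +
      (emit_cost (yarc_items y) * ?c + (8 * ?l p + (8 * ?l q +
      ((5 * length (?\<sigma>6 4) + 1) + (5 * length (?\<sigma>7 5) + 1))))))))
      (\<sigma>(0 := r, 2 := rev M @ \<sigma> 2, 3 := rev (Y @ enc_nat p @ enc_nat q) @ \<sigma> 3))"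
    by (simp only: edge_body_def)
  then show ?thesis
    by (rule runs_mono)
      (use holds_length[OF h2(1)] holds_length[OF h2(2)] in \<open>simp add: algebra_simps\<close>)
qed

lemma runs_finish:
  fixes \<sigma> :: "'a::finite sym store"
  assumes "\<sigma> 1 = []" "\<sigma> 2 = rev V" "\<sigma> 3 = rev E"
  obtains \<sigma>' where
    "runs finish \<sigma> ((length (all_syms :: 'a sym list) + 4) * (length (\<sigma> 2) + length (\<sigma> 3)) + 4) \<sigma>'"
    "\<sigma>' 1 = V @ [End] @ E @ [End]"
proof -
  let ?c = "length (all_syms :: 'a sym list) + 4"
  let ?\<sigma>1 = "\<sigma>(1 := End # \<sigma> 1)"
  let ?\<sigma>2 = "?\<sigma>1(3 := [], 1 := rev (?\<sigma>1 3) @ ?\<sigma>1 1)"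
  let ?\<sigma>3 = "?\<sigma>2(1 := End # ?\<sigma>2 1)"
  let ?\<sigma>4 = "?\<sigma>3(2 := [], 1 := rev (?\<sigma>3 2) @ ?\<sigma>3 1)"
  have 1: "runs (transfer 3 all_syms (\<lambda>c. [(1, c)])) ?\<sigma>1 (?c * length (?\<sigma>1 3) + 1) ?\<sigma>2"
    by (rule runs_move) auto
  have 2: "runs (transfer 2 all_syms (\<lambda>c. [(1, c)])) ?\<sigma>3 (?c * length (?\<sigma>3 2) + 1) ?\<sigma>4"
    by (rule runs_move) auto
  have "runs finish \<sigma> (1 + ((?c * length (?\<sigma>1 3) + 1) + (1 + (?c * length (?\<sigma>3 2) + 1)))) ?\<sigma>4"
    unfolding finish_def by (rule runs_Seq[OF runs_Push runs_Seq[OF 1 runs_Seq[OF runs_Push 2]]])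
  then have "runs finish \<sigma> (?c * (length (\<sigma> 2) + length (\<sigma> 3)) + 4) ?\<sigma>4"
    by (rule runs_mono) (simp add: algebra_simps)
  moreover have "?\<sigma>4 1 = V @ [End] @ E @ [End]" using assms by simp
  ultimately show thesis by (rule that[of ?\<sigma>4])
qed

lemma enc_nat_not_Nil [simp]: "enc_nat n \<noteq> []"
  by (simp add: enc_nat_def)

text \<open>This lets a loop recognize the end of a list by \<open>End\<close> on top of the
  input.\<close>

lemma hd_enc_nat: "hd (enc_nat n @ r :: 'a sym list) \<noteq> End"
proof (cases "digits n :: 'a sym list")
  case (Cons c cs)
  with set_digits[of n, where 'a = 'a] show ?thesis by (auto simp: enc_nat_def)
qed (simp add: enc_nat_def)

text \<open>The \<open>Suc\<close> terms are the rates of the two loops; \<open>18\<close> covers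
  reading \<open>s\<close> and \<open>t\<close>, popping the end marks and the last loop
  tests.\<close>

definition collect_cost :: "'a list \<Rightarrow> 'a list \<Rightarrow> 'a list \<Rightarrow> nat" where
  "collect_cost x y z = emit_cost (end_node_items (length x) (length z) :: 'a item list) +
     Suc (12 + emit_cost (key_items 0 4 4 :: 'a item list)) +
     Suc (13 + emit_cost (mid_items (length y) :: 'a item list) + emit_cost (yarc_items y)) +
     emit_cost (end_arc_items x z) + 18"

text \<open>The reduction must be a function of the string alone, which does not determine
  \<open>\<pi>\<close> off the edges; determinism of \<open>exec\<close> provides one.\<close>

definition result_of :: "'c prog \<Rightarrow> 'c list \<Rightarrow> 'c list" where
  "result_of P w = (THE \<sigma>. \<exists>n. exec P (init_store w) n \<sigma>) 1"

lemma result_of_eq: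
  assumes "exec P (init_store w) n \<sigma>"
  shows "result_of P w = \<sigma> 1"
proof -
  have "(THE \<sigma>. \<exists>n. exec P (init_store w) n \<sigma>) = \<sigma>"
  proof (rule the_equality)
    show "\<exists>n. exec P (init_store w) n \<sigma>" using assms by (rule exI)
    show "\<sigma>' = \<sigma>" if "\<exists>n. exec P (init_store w) n \<sigma>'" for \<sigma>'
      using that exec_deterministic[OF assms] by auto
  qed
  then show ?thesis by (simp add: result_of_def)
qed

section \<open>The text written for the graph\<close>

context gadget
begin

text \<open>The order is that in which \<open>collect\<close> writes the vertices.\<close>

definition node_list :: "nat list \<Rightarrow> (nat \<times> nat) list \<Rightarrow> node list" where
  "node_list vs es = map Pre [0..<length x] @ map Suf [1..<Suc (length z)] @ map Orig vs @
     concat (map (\<lambda>(u, v). map (\<lambda>i. Mid i u v) [1..<length y]) es)"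

definition arc_list :: "(nat \<times> nat) list \<Rightarrow> arc list" where
  "arc_list es = concat (map (\<lambda>(u, v). map (YArc u v) [0..<length y]) es) @
     map XArc [0..<length x] @ map ZArc [0..<length z]"

definition arc_code :: "arc \<Rightarrow> 'a sym list" where
  "arc_code a = enc_nat (name (src a)) @ enc_nat (name (tgt a)) @ Letter (alab a) # enc_prob (aprob a)"

lemma enc_edge_ends:
  "a \<in> arcs \<Longrightarrow> enc_edge (\<lambda>a. [Letter a]) graph prb (ends a) = arc_code a"
  by (simp add: enc_edge_def lab_ends prb_ends arc_code_def) (simp add: ends_def)

lemma set_node_list: "set vs = verts H \<Longrightarrow> set es = edges H \<Longrightarrow> set (node_list vs es) = nodes"
  by (force simp: node_list_def nodes_def)

lemma set_arc_list: "set es = edges H \<Longrightarrow> set (arc_list es) = arcs"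
  by (force simp: arc_list_def arcs_def)

lemma distinct_node_list: "distinct vs \<Longrightarrow> distinct es \<Longrightarrow> distinct (node_list vs es)"
proof -
  have "distinct es \<Longrightarrow> distinct (concat (map (\<lambda>(u, v). map (\<lambda>i. Mid i u v) [1..<length y]) es))"
    by (induction es) (auto simp: distinct_map inj_on_def)
  then show "distinct vs \<Longrightarrow> distinct es \<Longrightarrow> distinct (node_list vs es)"
    by (auto simp: node_list_def distinct_map inj_on_def)
qed

lemma distinct_arc_list: "distinct es \<Longrightarrow> distinct (arc_list es)"
proof -
  have "distinct es \<Longrightarrow> distinct (concat (map (\<lambda>(u, v). map (YArc u v) [0..<length y]) es))"
    by (induction es) (auto simp: distinct_map inj_on_def)
  then show "distinct es \<Longrightarrow> distinct (arc_list es)"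
    by (auto simp: arc_list_def distinct_map inj_on_def)
qed

text \<open>Injectivity of \<open>name\<close>, and of \<open>ends\<close> on \<open>arcs\<close>,
  keeps the lists of vertices and edges free of repetitions.\<close>

lemma encodes_graph_gadget:
  assumes "distinct vs" "set vs = verts H" "distinct es" "set es = edges H"
  shows "encodes_graph (\<lambda>a. [Letter a])
    (concat (map (\<lambda>\<nu>. enc_nat (name \<nu>)) (node_list vs es)) @ [End] @
      concat (map arc_code (arc_list es)) @ [End]) graph prb"
proof -
  have "distinct (map name (node_list vs es))"
    using distinct_node_list assms inj_name by (simp add: distinct_map inj_on_def inj_def)
  moreover have "distinct (map ends (arc_list es))"
    using distinct_arc_list assms set_arc_list inj_ends by (simp add: distinct_map)
  moreover have "map (enc_edge (\<lambda>a. [Letter a]) graph prb) (map ends (arc_list es)) =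
      map arc_code (arc_list es)"
    using set_arc_list[OF assms(4)] by (simp add: enc_edge_ends)
  moreover have "set (map name (node_list vs es)) = verts graph"
    "set (map ends (arc_list es)) = edges graph"
    using set_node_list[OF assms(2,4)] set_arc_list[OF assms(4)] by (simp_all add: graph_def)
  moreover have "map enc_nat (map name (node_list vs es)) = map (\<lambda>\<nu>. enc_nat (name \<nu>)) (node_list vs es)"
    by simp
  ultimately show ?thesis
    unfolding encodes_graph_def by metis
qed

lemma rendered_ynode_items:
  assumes "holds \<sigma> 4 u" "holds \<sigma> 5 v"
  shows "rendered \<sigma> (ynode_items (length y) i) = enc_nat (name (ynode u v i))"
  using rendered_key_items assms by (auto simp: ynode_items_def ynode_def enc_nat_name)

lemma rendered_xnode_items:
  assumes "holds \<sigma> 4 s" "holds \<sigma> 7 0"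
  shows "rendered \<sigma> (xnode_items (length x) i) = enc_nat (name (xnode i))"
  using rendered_key_items assms by (auto simp: xnode_items_def xnode_def enc_nat_name)

lemma rendered_znode_items:
  assumes "holds \<sigma> 5 t" "holds \<sigma> 7 0"
  shows "rendered \<sigma> (znode_items i) = enc_nat (name (znode i))"
  using rendered_key_items assms by (auto simp: znode_items_def znode_def enc_nat_name)

lemma rendered_end_arc_items:
  assumes "holds \<sigma> 4 s" "holds \<sigma> 5 t" "holds \<sigma> 7 0"
  shows "rendered \<sigma> (end_arc_items x z) =
    concat (map arc_code (map XArc [0..<length x] @ map ZArc [0..<length z]))"
  unfolding end_arc_items_def rendered_simps rendered_concat
  by (simp add: rendered_xnode_items rendered_znode_items assms arc_code_def o_def)

definition ypath_code :: "nat \<Rightarrow> nat \<Rightarrow> 'a sym list" where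
  "ypath_code u v = concat (map (\<lambda>i. enc_nat (name (ynode u v i)) @ enc_nat (name (ynode u v (Suc i))) @
     Letter (y ! i) # (if Suc i = length y then [] else enc_prob 1)) [0..<length y])"

lemma rendered_yarc_items:
  assumes "holds \<sigma> 4 u" "holds \<sigma> 5 v"
  shows "rendered \<sigma> (yarc_items y) = ypath_code u v"
  unfolding yarc_items_def rendered_simps rendered_concat
  by (simp add: rendered_ynode_items[OF assms] ypath_code_def)

text \<open>Only the last index differs: there \<open>ypath_code\<close> stops after the label, and
  the copied probability completes the arc.\<close>

lemma ypath_code_prob:
  "ypath_code u v @ enc_prob (\<pi> (u, v)) = concat (map arc_code (map (YArc u v) [0..<length y]))"
proof -
  obtain m where m: "length y = Suc m" using y by (cases "length y") auto
  then have "concat (map arc_code (map (YArc u v) [0..<m])) =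
      concat (map (\<lambda>i. enc_nat (name (ynode u v i)) @ enc_nat (name (ynode u v (Suc i))) @
        Letter (y ! i) # (if Suc i = length y then [] else enc_prob 1)) [0..<m])"
    by (auto simp: arc_code_def intro!: arg_cong[of _ _ concat])
  with m show ?thesis by (simp add: ypath_code_def arc_code_def)
qed

lemma runs_collect:
  fixes w :: "'a sym list"
  assumes w: "w = concat (map enc_nat vs) @ [End] @ concat (map (enc_edge (\<lambda>_. []) H \<pi>) es) @ [End] @
      enc_vertex_pair s t"
  obtains \<sigma> where "runs (collect x y z) (init_store w) (collect_cost x y z * Suc (length w)) \<sigma>"
    "\<sigma> 1 = []" "\<sigma> 2 = rev (concat (map (\<lambda>\<nu>. enc_nat (name \<nu>)) (node_list vs es)))"
    "\<sigma> 3 = rev (concat (map arc_code (arc_list es)))"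
proof -
  let ?N = "Suc (length w)"
  let ?\<sigma>0 = "init_store w"
  let ?E = "enc_edge (\<lambda>_. []) H \<pi> :: nat \<times> nat \<Rightarrow> 'a sym list"
  let ?p = "enc_vertex_pair s t :: 'a sym list"
  let ?r = "concat (map ?E es) @ End # ?p"
  let ?a = "end_node_items (length x) (length z) :: 'a item list"
  let ?b = "end_arc_items x z"
  let ?f = "\<lambda>u. enc_nat (name (Orig u)) :: 'a sym list"
  let ?g = "\<lambda>(u, v). concat (map (\<lambda>i. enc_nat (name (Mid i u v))) [1..<length y]) :: 'a sym list"
  let ?h = "\<lambda>(u, v). concat (map arc_code (map (YArc u v) [0..<length y]))"
  define A where "A = rendered ?\<sigma>0 ?a"
  let ?\<sigma>1 = "?\<sigma>0(2 := rev A @ ?\<sigma>0 2)"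
  let ?\<sigma>2 = "?\<sigma>1(0 := End # ?r, 2 := rev (concat (map ?f vs)) @ ?\<sigma>1 2,
    3 := rev (concat (map (\<lambda>_. []) vs)) @ ?\<sigma>1 3)"
  let ?\<sigma>3 = "?\<sigma>2(0 := tl (?\<sigma>2 0))"
  let ?\<sigma>4 = "?\<sigma>3(0 := End # ?p, 2 := rev (concat (map ?g es)) @ ?\<sigma>3 2,
    3 := rev (concat (map ?h es)) @ ?\<sigma>3 3)"
  let ?\<sigma>5 = "?\<sigma>4(0 := tl (?\<sigma>4 0))"
  let ?\<sigma>6 = "?\<sigma>5(0 := enc_nat t, 4 := rev (digits s) @ ?\<sigma>5 4)"
  let ?\<sigma>7 = "?\<sigma>6(0 := [], 5 := rev (digits t) @ ?\<sigma>6 5)"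
  let ?B = "rendered ?\<sigma>7 ?b"
  let ?\<sigma>8 = "?\<sigma>7(3 := rev ?B @ ?\<sigma>7 3)"
  let ?K = "12 + emit_cost (key_items 0 4 4 :: 'a item list)"
  let ?K' = "13 + emit_cost (mid_items (length y) :: 'a item list) + emit_cost (yarc_items y)"
  have init: "?\<sigma>0 0 = w" "k \<noteq> 0 \<Longrightarrow> ?\<sigma>0 k = []" for k by (simp_all add: init_store_def)
  \<comment> \<open>The only token used is the empty one on stack \<open>7\<close>, so the bound
    \<open>1\<close> suffices.\<close>
  have "tokens_ok 2 ?\<sigma>0 ?a 1"
    by (auto simp: tokens_ok_def init dest: Token_end_node_items)
  from runs_emit[OF this] have 1: "runs (emit 2 ?a) ?\<sigma>0 (emit_cost ?a * 1) ?\<sigma>1"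
    by (simp only: rendered_def A_def)
  have 2: "runs (WhileTop 0 (- {Some End}) vertex_body) ?\<sigma>1
      (Suc ?K * length (concat (map enc_nat vs) :: 'a sym list) + 1) ?\<sigma>2"
  proof (rule runs_foreach)
    fix u r and \<sigma> :: "'a sym store"
    assume "\<forall>k\<ge>4. \<sigma> k = []" "\<sigma> 0 = enc_nat u @ r"
    then show "runs vertex_body \<sigma> (?K * length (enc_nat u :: 'a sym list))
        (\<sigma>(0 := r, 2 := rev (?f u) @ \<sigma> 2, 3 := rev [] @ \<sigma> 3))"
      by (rule runs_vertex_body)
  next
    show "enc_nat u \<noteq> [] \<and> hd (enc_nat u :: 'a sym list) \<noteq> End" for u
      using hd_enc_nat[of u "[]"] by simp
  next
    show "\<forall>k\<ge>4. ?\<sigma>1 k = []" "?\<sigma>1 0 = concat (map enc_nat vs) @ End # ?r"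
      using init by (auto simp: w)
  qed
  have 4: "runs (WhileTop 0 (- {Some End}) (edge_body y)) ?\<sigma>3
      (Suc ?K' * length (concat (map ?E es)) + 1) ?\<sigma>4"
  proof (rule runs_foreach)
    fix e r and \<sigma> :: "'a sym store"
    assume \<sigma>: "\<forall>k\<ge>4. \<sigma> k = []" "\<sigma> 0 = ?E e @ r"
    obtain u v where e: "e = (u, v)" by (cases e)
    define p where "p = nat (fst (quotient_of (\<pi> e)))"
    define q where "q = nat (snd (quotient_of (\<pi> e)))"
    have E: "?E e = enc_nat u @ enc_nat v @ enc_nat p @ enc_nat q"
      by (simp add: enc_edge_def enc_prob_def p_def q_def e)
    have "runs (edge_body y) \<sigma> (?K' * length (enc_nat u @ enc_nat v @ enc_nat p @ enc_nat q :: 'a sym list))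
      (\<sigma>(0 := r, 2 := rev (?g e) @ \<sigma> 2, 3 := rev (ypath_code u v @ enc_nat p @ enc_nat q) @ \<sigma> 3))"
    proof (rule runs_edge_body[OF \<sigma>(1)])
      show "\<sigma> 0 = enc_nat u @ enc_nat v @ enc_nat p @ enc_nat q @ r" using \<sigma>(2) by (simp add: E)
      show "rendered \<tau> (mid_items (length y)) = ?g e" if "holds \<tau> 4 u" "holds \<tau> 5 v" for \<tau>
        using rendered_mid_items[OF that] by (simp add: e)
      show "rendered \<tau> (yarc_items y) = ypath_code u v" if "holds \<tau> 4 u" "holds \<tau> 5 v" for \<tau>
        by (rule rendered_yarc_items[OF that])
    qed
    moreover have "ypath_code u v @ enc_nat p @ enc_nat q = ?h e"
      using ypath_code_prob[of u v] by (simp add: e p_def q_def enc_prob_def)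
    ultimately show "runs (edge_body y) \<sigma> (?K' * length (?E e))
        (\<sigma>(0 := r, 2 := rev (?g e) @ \<sigma> 2, 3 := rev (?h e) @ \<sigma> 3))"
      by (simp only: E)
  next
    show "?E e \<noteq> [] \<and> hd (?E e) \<noteq> End" for e
      using hd_enc_nat by (simp add: enc_edge_def)
  next
    show "\<forall>k\<ge>4. ?\<sigma>3 k = []" "?\<sigma>3 0 = concat (map ?E es) @ End # ?p"
      using init by auto
  qed
  have 6: "runs (read_token 4) ?\<sigma>5 (7 * length (enc_nat s :: 'a sym list)) ?\<sigma>6"
    by (rule runs_read_token) (simp_all add: enc_vertex_pair_def)
  have 7: "runs (read_token 5) ?\<sigma>6 (7 * length (enc_nat t :: 'a sym list)) ?\<sigma>7"
    by (rule runs_read_token) simp_all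
  have h: "holds ?\<sigma>7 4 s" "holds ?\<sigma>7 5 t" "holds ?\<sigma>7 7 0"
    using init by (simp_all add: holds_def digits.simps)
  have len: "length w = length (concat (map enc_nat vs) :: 'a sym list) + length (concat (map ?E es)) +
      length (enc_nat s :: 'a sym list) + length (enc_nat t :: 'a sym list) + 2"
    by (simp add: w enc_vertex_pair_def)
  \<comment> \<open>The tokens \<open>s\<close> and \<open>t\<close> are part of the input, so their
    lengths are below its length.\<close>
  have "tokens_ok 3 ?\<sigma>7 ?b ?N"
    using holds_bits[OF h(1)] holds_bits[OF h(2)] holds_bits[OF h(3)] init len
      holds_length[OF h(1)] holds_length[OF h(2)]
    by (auto simp: tokens_ok_def dest!: Token_end_arc_items)
  from runs_emit[OF this] have 8: "runs (emit 3 ?b) ?\<sigma>7 (emit_cost ?b * ?N) ?\<sigma>8"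
    by (simp only: rendered_def)
  have "runs (collect x y z) ?\<sigma>0 (emit_cost ?a * 1 +
      ((Suc ?K * length (concat (map enc_nat vs) :: 'a sym list) + 1) + (1 +
      ((Suc ?K' * length (concat (map ?E es)) + 1) + (1 +
      (7 * length (enc_nat s :: 'a sym list) + (7 * length (enc_nat t :: 'a sym list) +
      emit_cost ?b * ?N))))))) ?\<sigma>8"
    unfolding collect_def
    by (rule runs_Seq[OF 1 runs_Seq[OF 2 runs_Seq[OF runs_Pop runs_Seq[OF 4 runs_Seq[OF runs_Pop
      runs_Seq[OF 6 runs_Seq[OF 7 8]]]]]]])
  then have "runs (collect x y z) ?\<sigma>0 (collect_cost x y z * ?N) ?\<sigma>8"
    by (rule runs_mono) (simp add: len collect_cost_def algebra_simps)
  moreover have "?\<sigma>8 1 = []" using init by simp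
  moreover have "?\<sigma>8 2 = rev (concat (map (\<lambda>\<nu>. enc_nat (name \<nu>)) (node_list vs es)))"
  proof -
    have "A = concat (map (\<lambda>\<nu>. enc_nat (name \<nu>)) (map Pre [0..<length x] @ map Suf [1..<Suc (length z)]))"
      unfolding A_def using init
      by (subst rendered_end_node_items) (simp_all add: holds_def digits.simps o_def del: upt_Suc)
    moreover have "concat (map ?g es) = concat (map (\<lambda>\<nu>. enc_nat (name \<nu>))
        (concat (map (\<lambda>(u, v). map (\<lambda>i. Mid i u v) [1..<length y]) es)))"
      by (induction es) (auto simp: o_def)
    ultimately show ?thesis using init by (simp add: node_list_def o_def del: upt_Suc)
  qed
  moreover have "?\<sigma>8 3 = rev (concat (map arc_code (arc_list es)))"
  proof -
    have "concat (map ?h es) = concat (map arc_code (concat (map (\<lambda>(u, v). map (YArc u v) [0..<length y]) es)))"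
      by (induction es) auto
    then show ?thesis
      using init rendered_end_arc_items[OF h] by (simp add: arc_list_def)
  qed
  ultimately show thesis by (rule that[of ?\<sigma>8])
qed

end

text \<open>Stacks \<open>2\<close> and \<open>3\<close> are each no longer than the time of
  \<open>collect\<close>, whence the factor \<open>2\<close> for the final transfers.\<close>

definition reduction_cost :: "'a::finite list \<Rightarrow> 'a list \<Rightarrow> 'a list \<Rightarrow> nat" where
  "reduction_cost x y z = collect_cost x y z * (1 + 2 * (length (all_syms :: 'a sym list) + 4)) + 4"

section \<open>Correctness of the reduction\<close>

lemma encodes_stconE:
  assumes "encodes_stcon w H \<pi> s t"
  obtains vs es where "prob_graph H \<pi>" "s \<in> verts H" "t \<in> verts H"
    "distinct vs" "set vs = verts H" "distinct es" "set es = edges H"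
    "w = concat (map enc_nat vs) @ [End] @ concat (map (enc_edge (\<lambda>_. []) H \<pi>) es) @ [End] @
      enc_vertex_pair s t"
proof -
  from assms obtain w' vs es where "prob_graph H \<pi>" "s \<in> verts H" "t \<in> verts H"
    "distinct vs" "set vs = verts H" "distinct es" "set es = edges H"
    "w = w' @ enc_vertex_pair s t"
    "w' = concat (map enc_nat vs) @ [End] @ concat (map (enc_edge (\<lambda>_. []) H \<pi>) es) @ [End]"
    unfolding encodes_stcon_def encodes_graph_def by blast
  then show thesis by (intro that[of vs es]) simp_all
qed

lemma exec_reduction:
  fixes x y z :: "'a::finite list"
  assumes nonempty: "x \<noteq> []" "y \<noteq> []" "z \<noteq> []" and w: "encodes_stcon w H \<pi> s t"
  obtains n \<sigma> where "exec (reduction x y z) (init_store w) n \<sigma>"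
    "n \<le> reduction_cost x y z * Suc (length w)"
    "encodes_pqe (\<sigma> 1) (gadget.graph x y z H s t) (gadget.prb x y z H \<pi> s t)"
proof -
  from w obtain vs es where H: "prob_graph H \<pi>" "s \<in> verts H" "t \<in> verts H"
    and enum: "distinct vs" "set vs = verts H" "distinct es" "set es = edges H"
    and w_eq: "w = concat (map enc_nat vs) @ [End] @ concat (map (enc_edge (\<lambda>_. []) H \<pi>) es) @ [End] @
      enc_vertex_pair s t"
    by (rule encodes_stconE)
  interpret gadget x y z H \<pi> s t
    using nonempty H by unfold_locales
  let ?V = "concat (map (\<lambda>\<nu>. enc_nat (name \<nu>)) (node_list vs es)) :: 'a sym list"
  let ?E = "concat (map arc_code (arc_list es))"
  let ?T = "collect_cost x y z * Suc (length w)"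
  let ?c = "length (all_syms :: 'a sym list) + 4"
  obtain \<sigma> where \<sigma>: "runs (collect x y z) (init_store w) ?T \<sigma>"
    "\<sigma> 1 = []" "\<sigma> 2 = rev ?V" "\<sigma> 3 = rev ?E"
    using w_eq by (rule runs_collect)
  obtain \<sigma>' where \<sigma>': "runs finish \<sigma> (?c * (length (\<sigma> 2) + length (\<sigma> 3)) + 4) \<sigma>'"
    "\<sigma>' 1 = ?V @ [End] @ ?E @ [End]"
    using \<sigma>(2-4) by (rule runs_finish)
  have "length (\<sigma> 2) \<le> ?T" "length (\<sigma> 3) \<le> ?T"
    using runs_length[OF \<sigma>(1), of 2] runs_length[OF \<sigma>(1), of 3] by (simp_all add: init_store_def)
  then have "?c * (length (\<sigma> 2) + length (\<sigma> 3)) \<le> ?c * (?T + ?T)"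
    by (intro mult_le_mono2 add_mono)
  then have "?T + (?c * (length (\<sigma> 2) + length (\<sigma> 3)) + 4) \<le> ?T + (?c * (?T + ?T) + 4 * Suc (length w))"
    by (intro add_mono) simp_all
  also have "\<dots> = reduction_cost x y z * Suc (length w)"
    by (simp only: reduction_cost_def) (simp add: algebra_simps)
  finally obtain n where n: "n \<le> reduction_cost x y z * Suc (length w)"
    "exec (reduction x y z) (init_store w) n \<sigma>'"
    using runs_Seq[OF \<sigma>(1) \<sigma>'(1)] le_trans unfolding runs_def reduction_def by blast
  have "encodes_pqe (\<sigma>' 1) graph prb"
    unfolding encodes_pqe_def \<sigma>'(2)
    using prob_graph_graph encodes_graph_gadget[OF enum] by blast
  from that[OF n(2,1) this] show thesis .
qed

theorem proposition7p6:
  fixes L :: "'a::finite list set"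
  assumes "regular_language L"
    and "\<not> bounded_RPQ L"
  shows "\<exists>f g :: 'a sym list \<Rightarrow> 'a sym list.
    polytime_on {w. \<exists>H \<pi> s t. encodes_stcon w H \<pi> s t} f \<and>
    polytime_on {w. \<exists>H \<pi> s t. encodes_stcon w H \<pi> s t} g \<and>
    (\<forall>w H \<pi> s t. encodes_stcon w H \<pi> s t \<longrightarrow>
      (\<exists>H' \<pi>' s' t'.
         encodes_pqe (f w) H' \<pi>' \<and>
         s' \<in> verts H' \<and> t' \<in> verts H' \<and> g w = enc_vertex_pair s' t' \<and>
         PQE (RPQ L) H' \<pi>' = stcon H \<pi> s t))"
proof -
  obtain x y z where nonempty: "x \<noteq> []" "y \<noteq> []" "z \<noteq> []"
    and L: "\<And>n. x @ concat (replicate n y) @ z \<in> infix_free L"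
    using infix_free_pumping[OF assms] by blast
  define f where "f = result_of (reduction x y z)"
  \<comment> \<open>The first and the last vertex of the construction have names that do not depend
    on the instance, so the pair is written by a constant function.\<close>
  define p :: "'a sym list" where "p = enc_vertex_pair (name (Pre 0)) (name (Suf (length z)))"
  have f: "\<exists>n \<sigma>. exec (reduction x y z) (init_store w) n \<sigma> \<and> \<sigma> 1 = f w \<and>
      n \<le> reduction_cost x y z * Suc (length w) \<and>
      encodes_pqe (f w) (gadget.graph x y z H s t) (gadget.prb x y z H \<pi> s t)"
    if "encodes_stcon w H \<pi> s t" for w H \<pi> s t
    using that by (rule exec_reduction[OF nonempty]) (auto simp: f_def result_of_eq)
  show ?thesis
  proof (rule exI[of _ f], rule exI[of _ "\<lambda>_. p"], intro conjI allI impI)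
    let ?c = "reduction_cost x y z"
    \<comment> \<open>The running time is in fact linear in the length of the input.\<close>
    have "poly [:?c, ?c:] n = ?c * Suc n" for n by simp
    with f show "polytime_on {w. \<exists>H \<pi> s t. encodes_stcon w H \<pi> s t} f"
      unfolding polytime_on_def
      by (intro exI[of _ "reduction x y z"] exI[of _ "[:?c, ?c:]"]) (simp only: mem_Collect_eq, blast)
  next
    \<comment> \<open>The last symbol pushed ends on top, so \<open>p\<close> is pushed in
      reverse.\<close>
    have "(\<lambda>k. rev (pushed_to k (map (Pair 1) (rev p))) @ init_store w k) 1 = p" for w :: "'a sym list"
      by (simp add: pushed_to_map_Pair init_store_def)
    with runs_pushes[of "map (Pair 1) (rev p)"]
    show "polytime_on {w. \<exists>H \<pi> s t. encodes_stcon w H \<pi> s t} (\<lambda>_. p)"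
      unfolding polytime_on_def runs_def
      by (intro exI[of _ "pushes (map (Pair 1) (rev p))"] exI[of _ "[:Suc (length p):]"])
        (simp, blast)
  next
    fix w :: "'a sym list" and H \<pi> s t
    assume w: "encodes_stcon w H \<pi> s t"
    then have "prob_graph H \<pi>" "s \<in> verts H" "t \<in> verts H" by (auto simp: encodes_stcon_def)
    with nonempty interpret gadget x y z H \<pi> s t by unfold_locales
    have "name (Pre 0) \<in> verts graph" "name (Suf (length z)) \<in> verts graph"
      using x z by (simp_all add: graph_def)
    with f[OF w] PQE_graph[OF L] show "\<exists>H' \<pi>' s' t'. encodes_pqe (f w) H' \<pi>' \<and>
        s' \<in> verts H' \<and> t' \<in> verts H' \<and> p = enc_vertex_pair s' t' \<and>
        PQE (RPQ L) H' \<pi>' = stcon H \<pi> s t"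
      unfolding p_def by blast
  qed
qed

end
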